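(* For any integer $m\geq 3$ and any distinct positive integers $n_1<\cdots<n_m$, there is a nonzero homogeneous polynomial $f(x_1,\ldots,x_m)\in\mathbb{C}[x_1,\ldots,x_m]$ such that $$f(\Pi_{q^{n_1}},\ldots,\Pi_{q^{n_m}})=0$$ identically (as a function of $z$ in the upper half plane, where $q=e^{2\pi i z}$).
   Context: Let $q=e^{2\pi i z}$ with $\mathrm{Im}\, z>0$, and for rational $r$ put $q^{r}:=e^{2\pi i r z}$. Write $(a;q)_\infty=\prod_{n=0}^\infty(1-aq^n)$. Define $$\Pi_q:=q^{1/4}\frac{(q^2;q^2)_\infty^2}{(q;q^2)_\infty^2},$$ and for a positive integer $n$ let $\Pi_{q^n}$ denote the function obtained by replacing $q$ by $q^n$ (equivalently $z$ by $nz$), i.e. $\Pi_{q^n}=q^{n/4}\frac{(q^{2n};q^{2n})_\infty^2}{(q^n;q^{2n})_\infty^2}$. *)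

theory Defs
  imports "HOL-Analysis.Analysis" "HOL-Library.Poly_Mapping"
begin

definition qpochhammer_inf :: "complex \<Rightarrow> complex \<Rightarrow> complex" where
  "qpochhammer_inf a q = prodinf (\<lambda>n. 1 - a * q ^ n)"

(* q^r for rational r is a function of z, not of q: no branch of a root is chosen. *)
definition qpow :: "complex \<Rightarrow> rat \<Rightarrow> complex" where
  "qpow z r = exp (2 * of_real pi * \<i> * of_rat r * z)"

(* Pi_q as a function of z; Pi_{q^n} is the function z |-> PiQ (n z), see PiQ_of_nat_mult. *)
definition PiQ :: "complex \<Rightarrow> complex" where
  "PiQ z = (let q = qpow z 1 in
     qpow z (1/4) * (qpochhammer_inf (q\<^sup>2) (q\<^sup>2))\<^sup>2 / (qpochhammer_inf q (q\<^sup>2))\<^sup>2)"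

lemma PiQ_of_nat_mult:
  "PiQ (of_nat n * z) = (let q = qpow z 1 in
     qpow z (of_nat n / 4) * (qpochhammer_inf (q ^ (2 * n)) (q ^ (2 * n)))\<^sup>2
       / (qpochhammer_inf (q ^ n) (q ^ (2 * n)))\<^sup>2)"
proof -
  have "qpow (of_nat n * z) 1 = qpow z 1 ^ n"
    by (simp add: qpow_def exp_of_nat_mult [symmetric] algebra_simps)
  moreover have "qpow (of_nat n * z) (1/4) = qpow z (of_nat n / 4)"
    by (simp add: qpow_def of_rat_divide algebra_simps)
  ultimately show ?thesis
    by (simp add: PiQ_def Let_def power_mult [symmetric] mult.commute)
qed

(* Polynomials over 'a in variables x_i indexed by nat: a monomial is a finitely supported
   exponent vector, a polynomial a finitely supported family of coefficients of monomials. *)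
type_synonym 'a mvpoly = "(nat \<Rightarrow>\<^sub>0 nat) \<Rightarrow>\<^sub>0 'a"

definition mv_vars :: "'a::zero mvpoly \<Rightarrow> nat set" where
  "mv_vars f = (\<Union>e\<in>Poly_Mapping.keys f. Poly_Mapping.keys e)"

definition mv_eval :: "(nat \<Rightarrow> 'a) \<Rightarrow> 'a::comm_semiring_1 mvpoly \<Rightarrow> 'a" where
  "mv_eval x f = (\<Sum>e\<in>Poly_Mapping.keys f. Poly_Mapping.lookup f e *
     (\<Prod>i\<in>Poly_Mapping.keys e. x i ^ Poly_Mapping.lookup e i))"

definition mv_total_degree :: "(nat \<Rightarrow>\<^sub>0 nat) \<Rightarrow> nat" where
  "mv_total_degree e = (\<Sum>i\<in>Poly_Mapping.keys e. Poly_Mapping.lookup e i)"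

definition mv_homogeneous :: "'a::zero mvpoly \<Rightarrow> bool" where
  "mv_homogeneous f \<longleftrightarrow> (\<exists>d. \<forall>e\<in>Poly_Mapping.keys f. mv_total_degree e = d)"

end

theory Submission
  imports Defs "HOL-Complex_Analysis.Complex_Analysis"
begin

text \<open>
  With \<open>\<Delta>(z) = q \<Prod>(1 - q^n)^24\<close> one has \<open>\<Pi>(z)^12 = \<Delta>(2 z)^2 / \<Delta>(z)\<close>. The images of
  \<open>z \<mapsto> \<Pi>(n z)^12\<close> under the slash action of the modular group form a finite set, because up to left
  multiplication by unimodular matrices there are finitely many integer matrices of a given
  determinant. Three such functions admit \<open>(e + 1)^2\<close> monomials of degree \<open>2 e\<close>, so some nonzero
  combination of these vanishes at the cusp to order about \<open>e^2\<close>. Its conjugates lie in a finite set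
  whose size is bounded independently of \<open>e\<close>; their product is a modular form for the full modular
  group of weight linear in \<open>e\<close>, vanishing to order quadratic in \<open>e\<close>, hence zero. So one conjugate is
  zero, and with it the combination itself.
\<close>

section \<open>Modularity of the discriminant\<close>

text \<open>In terms of the Dedekind eta function, \<open>PiQ z\<close> is eta(2z)^4 / eta(z)^2, of
  weight 1 with a nontrivial multiplier system. The twelfth power removes both the quarter power of
  q and the multipliers, so the only transformation law needed is that of the discriminant under z
  -> -1/z, which is derived here from theta products. Three functions are the least number for which
  the count works: two would give only 2 e + 1 monomials of degree 2 e, hence a vanishing order
  linear in e, of the same growth as the weight. The obstacle is that vanishing at the cusp is known
  for one conjugate only; the others may have poles there, because a discriminant stands in the
  denominator. Their pole orders are at most linear in e, so the product still vanishes to quadratic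
  order. For the same reason no exact valence formula is required: a maximum principle argument with
  crude constants suffices.\<close>

lemma holomorphic_on_prodinf:
  fixes f :: "nat \<Rightarrow> complex \<Rightarrow> complex"
  assumes S: "open S" and hol: "\<And>n. f n holomorphic_on S"
    and bound: "\<And>x r. cball x r \<subseteq> S \<Longrightarrow> r > 0 \<Longrightarrow>
      \<exists>M. summable M \<and> (\<forall>n. \<forall>y\<in>cball x r. norm (f n y - 1) \<le> M n)"
  shows "(\<lambda>x. prodinf (\<lambda>n. f n x)) holomorphic_on S"
proof (rule holomorphic_uniform_sequence[OF S])
  show "(\<lambda>x. \<Prod>n<N. f n x) holomorphic_on S" for N
    by (intro holomorphic_intros hol)
  fix x assume "x \<in> S"
  with S obtain r where r: "r > 0" "cball x r \<subseteq> S"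
    by (meson open_contains_cball)
  from bound[OF r(2,1)] obtain M
    where M: "summable M" "\<And>n y. y \<in> cball x r \<Longrightarrow> norm (f n y - 1) \<le> M n" by blast
  have cont: "continuous_on (cball x r) (f n)" for n
    using hol holomorphic_on_imp_continuous_on holomorphic_on_subset r(2) by blast
  have u: "uniformly_convergent_on (cball x r) (\<lambda>N y. \<Sum>n<N. norm (f n y - 1))"
    by (rule Weierstrass_m_test'[where M = M]) (use M in auto)
  have u2: "uniformly_convergent_on (cball x r) (\<lambda>N y. \<Prod>n<N. f n y)"
    by (rule uniformly_convergent_on_prod'[OF cont compact_cball u])
  have "lim (\<lambda>N. \<Prod>n<N. f n y) = prodinf (\<lambda>n. f n y)" if y: "y \<in> cball x r" for y
  proof -
    have "summable (\<lambda>n. norm (f n y - 1))"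
      by (rule summable_comparison_test'[OF M(1), of 0]) (use M(2)[OF y] in auto)
    hence "convergent_prod (\<lambda>n. f n y)"
      by (intro abs_convergent_prod_imp_convergent_prod summable_imp_abs_convergent_prod)
    from convergent_prod_LIMSEQ[OF this] show ?thesis
      by (subst (asm) LIMSEQ_lessThan_iff_atMost[symmetric]) (rule limI)
  qed
  with u2 have "uniform_limit (cball x r) (\<lambda>N y. \<Prod>n<N. f n y) (\<lambda>y. prodinf (\<lambda>n. f n y)) sequentially"
    unfolding uniformly_convergent_uniform_limit_iff by (subst uniform_limit_cong') auto
  thus "\<exists>d>0. cball x d \<subseteq> S \<and> uniform_limit (cball x d) (\<lambda>N y. \<Prod>n<N. f n y) (\<lambda>y. prodinf (\<lambda>n. f n y)) sequentially"
    using r by blast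
qed

section \<open>The q-Pochhammer symbol\<close>

context
  fixes q :: complex
  assumes q: "norm q < 1"
begin

lemma qpochhammer_inf_convergent: "convergent_prod (\<lambda>n. 1 - a * q ^ n)"
  using q by (intro abs_convergent_prod_imp_convergent_prod summable_imp_abs_convergent_prod)
    (auto simp: norm_mult norm_power intro!: summable_mult summable_geometric)

lemma qpochhammer_inf_tendsto: "(\<lambda>N. \<Prod>n<N. 1 - a * q ^ n) \<longlonglongrightarrow> qpochhammer_inf a q"
  using convergent_prod_LIMSEQ[OF qpochhammer_inf_convergent[of a]]
  unfolding qpochhammer_inf_def by (subst (asm) LIMSEQ_lessThan_iff_atMost[symmetric])

lemma qpochhammer_inf_rec: "qpochhammer_inf a q = (1 - a) * qpochhammer_inf (a * q) q"
proof (rule LIMSEQ_unique)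
  show "(\<lambda>N. \<Prod>n<Suc N. 1 - a * q ^ n) \<longlonglongrightarrow> qpochhammer_inf a q"
    using qpochhammer_inf_tendsto[of a] by (rule LIMSEQ_Suc)
  have "(\<lambda>N. (1 - a) * (\<Prod>n<N. 1 - a * q * q ^ n)) \<longlonglongrightarrow> (1 - a) * qpochhammer_inf (a * q) q"
    by (intro tendsto_mult_left qpochhammer_inf_tendsto)
  also have "(\<lambda>N. (1 - a) * (\<Prod>n<N. 1 - a * q * q ^ n)) = (\<lambda>N. \<Prod>n<Suc N. 1 - a * q ^ n)"
    by (subst prod.lessThan_Suc_shift) (simp add: mult_ac)
  finally show "(\<lambda>N. \<Prod>n<Suc N. 1 - a * q ^ n) \<longlonglongrightarrow> (1 - a) * qpochhammer_inf (a * q) q" .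
qed

lemma qpochhammer_inf_eq_0_iff: "qpochhammer_inf a q = 0 \<longleftrightarrow> (\<exists>n. a * q ^ n = 1)"
proof -
  have "qpochhammer_inf a q = 0 \<longleftrightarrow> (\<exists>n. 1 - a * q ^ n = 0)"
    using has_prod_eq_0_iff[OF convergent_prod_has_prod[OF qpochhammer_inf_convergent[of a]]]
    unfolding qpochhammer_inf_def by auto
  thus ?thesis by simp
qed

lemma qpochhammer_inf_nonzero:
  assumes "norm a < 1" shows "qpochhammer_inf a q \<noteq> 0"
proof -
  have "norm (a * q ^ n) < 1" for n
  proof -
    have "norm a * norm q ^ n \<le> norm a * 1"
      using q by (intro mult_left_mono power_le_one) auto
    thus ?thesis using assms by (simp add: norm_mult norm_power)
  qed
  thus ?thesis unfolding qpochhammer_inf_eq_0_iff by (metis norm_one less_irrefl)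
qed

lemma qpochhammer_inf_holomorphic: "(\<lambda>a. qpochhammer_inf a q) holomorphic_on UNIV"
  unfolding qpochhammer_inf_def
proof (rule holomorphic_on_prodinf)
  fix x :: complex and r :: real assume "r > 0"
  have "norm y \<le> norm x + r" if "y \<in> cball x r" for y
    using that norm_triangle_ineq2[of y x] by (simp add: dist_norm norm_minus_commute)
  thus "\<exists>M. summable M \<and> (\<forall>n. \<forall>y\<in>cball x r. norm (1 - y * q ^ n - 1) \<le> M n)"
    using q by (intro exI[of _ "\<lambda>n. (norm x + r) * norm q ^ n"])
      (auto simp: norm_mult norm_power intro!: summable_mult summable_geometric mult_right_mono)
qed (auto intro!: holomorphic_intros)

lemma qpochhammer_inf_compose_holomorphic:
  "f holomorphic_on S \<Longrightarrow> (\<lambda>w. qpochhammer_inf (f w) q) holomorphic_on S"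
  using holomorphic_on_compose_gen[OF _ qpochhammer_inf_holomorphic, of f S] by (simp add: o_def)

end

text \<open>Here the base varies too, so holomorphy in the first argument is not enough. This makes
  \<open>Delta\<close> and the twelfth powers holomorphic functions of \<open>ce z\<close>. On a
  closed ball inside the disc the largest modulus \<open>t\<close> is below 1, and
  \<open>t ^ Suc n\<close> is a convergent majorant.\<close>

lemma qpochhammer_inf_diag_holomorphic: "(\<lambda>q. qpochhammer_inf q q) holomorphic_on ball 0 1"
  unfolding qpochhammer_inf_def
proof (rule holomorphic_on_prodinf)
  fix x :: complex and r :: real assume r: "cball x r \<subseteq> ball 0 1" "r > 0"
  have "compact (norm ` cball x r)"
    by (intro compact_continuous_image continuous_intros compact_cball)
  then obtain t where t: "t \<in> norm ` cball x r" "\<And>s. s \<in> norm ` cball x r \<Longrightarrow> s \<le> t"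
    using compact_attains_sup[of "norm ` cball x r"] r(2) by auto
  have t1: "0 \<le> t" "t < 1" using t(1) r(1) by (auto simp: subset_iff)
  have "norm y ^ Suc n \<le> t ^ Suc n" if "y \<in> cball x r" for y n
    using t(2)[OF imageI[OF that]] by (intro power_mono) auto
  thus "\<exists>M. summable M \<and> (\<forall>n. \<forall>y\<in>cball x r. norm (1 - y * y ^ n - 1) \<le> M n)"
    using t1 by (intro exI[of _ "\<lambda>n. t ^ Suc n"])
      (auto simp: norm_mult norm_power  summable_geometric simp del: summable_Suc_iff intro!: summable_mult)
qed (auto intro!: holomorphic_intros)

lemma norm_power2_less_1: "norm (q :: complex) < 1 \<Longrightarrow> norm (q\<^sup>2) < 1"
  by (simp add: norm_power power_less_one_iff)

lemma qpochhammer_inf_mult_uminus: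
  assumes "norm q < 1"
  shows "qpochhammer_inf a q * qpochhammer_inf (- a) q = qpochhammer_inf (a\<^sup>2) (q\<^sup>2)"
proof (rule LIMSEQ_unique)
  show "(\<lambda>N. (\<Prod>n<N. 1 - a * q ^ n) * (\<Prod>n<N. 1 - (-a) * q ^ n)) \<longlonglongrightarrow>
      qpochhammer_inf a q * qpochhammer_inf (- a) q"
    by (intro tendsto_mult qpochhammer_inf_tendsto assms)
  have *: "1 - a\<^sup>2 * (q\<^sup>2) ^ n = (1 - a * q ^ n) * (1 - (-a) * q ^ n)" for n
    by (simp add: algebra_simps power2_eq_square power_mult_distrib)
  show "(\<lambda>N. (\<Prod>n<N. 1 - a * q ^ n) * (\<Prod>n<N. 1 - (-a) * q ^ n)) \<longlonglongrightarrow> qpochhammer_inf (a\<^sup>2) (q\<^sup>2)"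
    using qpochhammer_inf_tendsto[OF norm_power2_less_1[OF assms], of "a\<^sup>2"]
    by (simp only: * prod.distrib)
qed

text \<open>Even and odd exponents of \<open>q\<close> are separated: \<open>N\<close> factors of
  each kind make up the first \<open>2 * N\<close> factors of the whole product.\<close>

lemma qpochhammer_inf_even_odd:
  assumes "norm q < 1"
  shows "qpochhammer_inf a (q\<^sup>2) * qpochhammer_inf (a * q) (q\<^sup>2) = qpochhammer_inf a q"
proof (rule LIMSEQ_unique)
  show "(\<lambda>N. (\<Prod>n<N. 1 - a * (q\<^sup>2) ^ n) * (\<Prod>n<N. 1 - a * q * (q\<^sup>2) ^ n)) \<longlonglongrightarrow>
      qpochhammer_inf a (q\<^sup>2) * qpochhammer_inf (a * q) (q\<^sup>2)"
    by (intro tendsto_mult qpochhammer_inf_tendsto norm_power2_less_1 assms)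
  have "(\<Prod>n<N. 1 - a * (q\<^sup>2) ^ n) * (\<Prod>n<N. 1 - a * q * (q\<^sup>2) ^ n) = (\<Prod>n<2*N. 1 - a * q ^ n)" for N
    by (induction N) (auto simp: power_mult[symmetric] mult_ac)
  moreover have "(\<lambda>N. \<Prod>n<2*N. 1 - a * q ^ n) \<longlonglongrightarrow> qpochhammer_inf a q"
    using LIMSEQ_subseq_LIMSEQ[OF qpochhammer_inf_tendsto[OF assms, of a], of "\<lambda>N. 2*N"]
    by (simp add: strict_mono_def o_def)
  ultimately show "(\<lambda>N. (\<Prod>n<N. 1 - a * (q\<^sup>2) ^ n) * (\<Prod>n<N. 1 - a * q * (q\<^sup>2) ^ n)) \<longlonglongrightarrow> qpochhammer_inf a q"
    by simp
qed

text \<open>The zeros of \<open>g\<close> are simple and are cancelled by zeros of \<open>f\<close>,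
  so every singularity is removable. The values there are spelled out as quotients of derivatives so
  that periodicity can later be checked at these points as well.\<close>

lemma quotient_holomorphic:
  assumes f: "f holomorphic_on UNIV" and g: "g holomorphic_on UNIV"
    and fg: "\<And>w. g w = 0 \<Longrightarrow> f w = 0 \<and> deriv g w \<noteq> 0"
  shows "(\<lambda>w. if g w = 0 then deriv f w / deriv g w else f w / g w) holomorphic_on UNIV"
    (is "?R holomorphic_on UNIV")
proof -
  have "?R field_differentiable at a" for a
  proof (cases "g a = 0")
    case False
    define U where "U = {w. g w \<noteq> 0}"
    have "open U" unfolding U_def
      by (intro open_Collect_neq holomorphic_on_imp_continuous_on[OF g] continuous_intros)
    moreover have "(\<lambda>w. f w / g w) holomorphic_on U"
      by (intro holomorphic_intros holomorphic_on_subset[OF f] holomorphic_on_subset[OF g]) (auto simp: U_def)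
    hence "?R holomorphic_on U" by (rule holomorphic_transform) (auto simp: U_def)
    moreover have "a \<in> U" using False by (simp add: U_def)
    ultimately show ?thesis by (blast intro: holomorphic_on_imp_differentiable_at)
  next
    case True
    define f1 where "f1 = (\<lambda>w. if w = a then deriv f a else (f w - f a) / (w - a))"
    define g1 where "g1 = (\<lambda>w. if w = a then deriv g a else (g w - g a) / (w - a))"
    have f1: "f1 holomorphic_on UNIV" unfolding f1_def by (rule pole_lemma[OF f]) auto
    have g1: "g1 holomorphic_on UNIV" unfolding g1_def by (rule pole_lemma[OF g]) auto
    \<comment> \<open>On this set \<open>a\<close> is the only zero of \<open>g\<close>.\<close>
    define U where "U = {w. g1 w \<noteq> 0}"
    have U: "open U" unfolding U_def
      by (intro open_Collect_neq holomorphic_on_imp_continuous_on[OF g1] continuous_intros)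
    have a: "a \<in> U" using fg[OF True] by (auto simp: U_def g1_def)
    have "(\<lambda>w. f1 w / g1 w) holomorphic_on U"
      by (intro holomorphic_intros holomorphic_on_subset[OF f1] holomorphic_on_subset[OF g1]) (auto simp: U_def)
    moreover have "f1 w / g1 w = ?R w" if "w \<in> U" for w
    proof (cases "w = a")
      case False
      thus ?thesis using that fg[OF True] True by (simp add: U_def f1_def g1_def)
    qed (use True in \<open>simp add: f1_def g1_def\<close>)
    ultimately have "?R holomorphic_on U" by (rule holomorphic_transform)
    thus ?thesis using U a by (rule holomorphic_on_imp_differentiable_at)
  qed
  thus ?thesis by (simp add: holomorphic_on_def)
qed

section \<open>Theta products and their quasi-periodicity\<close>

definition ce :: "complex \<Rightarrow> complex" where "ce w = exp (2 * of_real pi * \<i> * w)"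

lemma ce_add: "ce (w + v) = ce w * ce v" by (simp add: ce_def ring_distribs exp_add)
lemma ce_minus: "ce (- w) = inverse (ce w)" by (simp add: ce_def exp_minus)
lemma ce_nonzero [simp]: "ce w \<noteq> 0" by (simp add: ce_def)
lemma ce_1 [simp]: "ce 1 = 1" by (simp add: ce_def)
lemma ce_half [simp]: "ce (1/2) = -1" by (simp add: ce_def)
lemma norm_ce: "norm (ce w) = exp (- 2 * pi * Im w)" by (simp add: ce_def)
lemma norm_ce_less_1: "Im z > 0 \<Longrightarrow> norm (ce z) < 1" by (simp add: norm_ce)
lemma ce_power: "ce w ^ n = ce (of_nat n * w)"
  by (simp add: ce_def exp_of_nat_mult[symmetric] mult_ac)
lemma ce_holomorphic: "ce holomorphic_on A" unfolding ce_def by (intro holomorphic_intros)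

lemma ce_eq_1_iff: "ce w = 1 \<longleftrightarrow> w \<in> \<int>"
proof -
  have "ce w = 1 \<longleftrightarrow> (\<exists>n::int. w = of_int n)"
    unfolding ce_def exp_eq_1 by (auto simp: complex_eq_iff mult_ac)
  thus ?thesis by (auto simp: Ints_def)
qed

text \<open>Jacobi's theta function as in the triple product, without its factor
  \<open>qpochhammer_inf (ce z) (ce z)\<close> and its exponential prefactor. Its zeros are the
  points of the lattice spanned by 1 and \<open>z\<close>.\<close>

definition theta_prod :: "complex \<Rightarrow> complex \<Rightarrow> complex" where
  "theta_prod w z = qpochhammer_inf (ce w) (ce z) * qpochhammer_inf (ce z / ce w) (ce z)"

text \<open>The parallelogram is half-open so that 0 is the only lattice point in it; zeros of theta
  products then need inspection at 0 only.\<close>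

lemma lattice_induct:
  fixes z :: complex
  assumes z: "Im z > 0"
    and step: "\<And>w. P w \<longleftrightarrow> P (w + 1)" "\<And>w. P w \<longleftrightarrow> P (w + z)"
    and base: "\<And>s t. s \<in> {0..<1} \<Longrightarrow> t \<in> {0..<1} \<Longrightarrow> P (of_real s + of_real t * z)"
  shows "P w"
proof -
  have shift: "P (w + of_int n * v) \<longleftrightarrow> P w" if "\<And>w. P w \<longleftrightarrow> P (w + v)" for v w and n :: int
  proof (induction n rule: int_induct[of _ 0])
    case (step1 i) thus ?case using that[of "w + of_int i * v"] by (simp add: algebra_simps)
  next
    case (step2 i) thus ?case using that[of "w + of_int (i - 1) * v"] by (simp add: algebra_simps)
  qed auto
  define t where "t = Im w / Im z"
  define s where "s = Re w - t * Re z"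
  have w: "w = of_real s + of_real t * z"
    using z by (simp add: complex_eq_iff s_def t_def)
  have "P (of_real (frac s) + of_real (frac t) * z)"
    by (intro base) (auto simp: frac_lt_1)
  also have "of_real (frac s) + of_real (frac t) * z = (w + of_int (-\<lfloor>t\<rfloor>) * z) + of_int (-\<lfloor>s\<rfloor>) * 1"
    unfolding w by (simp add: frac_def algebra_simps)
  finally show ?thesis
    unfolding shift[where v = 1, OF step(1)] shift[where v = z, OF step(2)] .
qed

lemma doubly_periodic_entire_constant:
  assumes z: "Im z > 0" and hol: "f holomorphic_on UNIV"
    and per: "\<And>w. f (w + 1) = f w" "\<And>w. f (w + z) = f w"
  obtains c where "\<And>w. f w = c"
proof -
  define K where "K = (\<lambda>(s, t). of_real s + of_real t * z) ` ({0..1::real} \<times> {0..1::real})"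
  have "compact K" unfolding K_def
    by (intro compact_continuous_image compact_Times)
       (auto intro!: continuous_intros simp: case_prod_unfold)
  hence "bounded (f ` K)"
    by (intro compact_imp_bounded compact_continuous_image
          continuous_on_subset[OF holomorphic_on_imp_continuous_on[OF hol]]) auto
  then obtain B where B: "\<And>w. w \<in> K \<Longrightarrow> norm (f w) \<le> B" by (auto simp: bounded_iff)
  have "norm (f w) \<le> B" for w
  proof (rule lattice_induct[OF z, of "\<lambda>w. norm (f w) \<le> B"])
    fix s t :: real assume "s \<in> {0..<1}" "t \<in> {0..<1}"
    hence "of_real s + of_real t * z \<in> K" unfolding K_def by (intro image_eqI[of _ _ "(s,t)"]) auto
    thus "norm (f (of_real s + of_real t * z)) \<le> B" by (rule B)
  qed (auto simp: per)
  hence "bounded (range f)" by (auto simp: bounded_iff)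
  from Liouville_theorem[OF hol this] show ?thesis using that by (auto simp: constant_on_def)
qed

lemma theta_prod_holomorphic:
  assumes "Im z > 0" shows "(\<lambda>w. theta_prod w z) holomorphic_on UNIV"
  unfolding theta_prod_def using norm_ce_less_1[OF assms]
  by (auto intro!: holomorphic_intros qpochhammer_inf_compose_holomorphic ce_holomorphic)

lemma theta_prod_plus_1: "theta_prod (w + 1) z = theta_prod w z"
  by (simp add: theta_prod_def ce_add)

text \<open>Once the factor \<open>1 - ce w\<close> is split off, the remaining product is even in
  \<open>w\<close>.\<close>

lemma theta_prod_uminus:
  assumes "Im z > 0" shows "theta_prod (- w) z = - theta_prod w z / ce w"
proof -
  note q = norm_ce_less_1[OF assms]
  have "theta_prod w z = (1 - ce w) * qpochhammer_inf (ce w * ce z) (ce z) * qpochhammer_inf (ce z / ce w) (ce z)"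
    unfolding theta_prod_def by (subst qpochhammer_inf_rec[OF q, of "ce w"]) simp
  moreover have "theta_prod (- w) z = (1 - inverse (ce w)) * qpochhammer_inf (inverse (ce w) * ce z) (ce z) * qpochhammer_inf (ce w * ce z) (ce z)"
    unfolding theta_prod_def ce_minus
    by (subst qpochhammer_inf_rec[OF q, of "inverse (ce w)"]) (simp add: field_simps)
  moreover have "inverse (ce w) * ce z = ce z / ce w" "(1 - inverse (ce w)) = - (1 - ce w) / ce w"
    by (simp_all add: field_simps)
  ultimately show ?thesis by (simp only: times_divide_eq_left times_divide_eq_right mult_minus_left mult_minus_right divide_minus_left mult_ac)
qed

text \<open>Shifting \<open>w\<close> by \<open>z\<close> gives the same two Pochhammer factors as
  reflecting \<open>w\<close>, in the other order.\<close>

lemma theta_prod_plus_period: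
  assumes "Im z > 0" shows "theta_prod (w + z) z = - theta_prod w z / ce w"
  unfolding theta_prod_uminus[OF assms, symmetric]
  by (simp add: theta_prod_def ce_add ce_minus field_simps)

lemma theta_prod_minus_period:
  assumes "Im z > 0" shows "theta_prod (w - z) z = - theta_prod w z * ce w / ce z"
proof -
  have "ce (w - z) = ce w / ce z" using ce_add[of w "-z"] by (simp add: ce_minus field_simps)
  thus ?thesis using theta_prod_plus_period[OF assms, of "w - z"] by simp
qed

lemma theta_prod_0: "Im z > 0 \<Longrightarrow> theta_prod 0 z = 0"
  using qpochhammer_inf_rec[OF norm_ce_less_1[of z], of 1] by (simp add: theta_prod_def ce_def)

lemma theta_prod_deriv_0:
  assumes z: "Im z > 0"
  shows "((\<lambda>w. theta_prod w z) has_field_derivative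
     - (2 * of_real pi * \<i>) * (qpochhammer_inf (ce z) (ce z))\<^sup>2) (at 0)"
proof -
  note q = norm_ce_less_1[OF z]
  define u where "u = (\<lambda>w. qpochhammer_inf (ce w * ce z) (ce z) * qpochhammer_inf (ce z / ce w) (ce z))"
  have "u holomorphic_on UNIV" unfolding u_def using q
    by (auto intro!: holomorphic_intros qpochhammer_inf_compose_holomorphic ce_holomorphic)
  then obtain u' where u': "(u has_field_derivative u') (at 0)"
    by (auto simp: holomorphic_on_def field_differentiable_def)
  have eq: "(\<lambda>w. theta_prod w z) = (\<lambda>w. (1 - ce w) * u w)"
    unfolding theta_prod_def u_def by (subst qpochhammer_inf_rec[OF q]) (simp add: mult_ac)
  have "((\<lambda>w. (1 - ce w) * u w) has_field_derivative - (2 * of_real pi * \<i>) * u 0) (at 0)"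
    unfolding ce_def by (rule derivative_eq_intros u' refl | simp)+
  moreover have "u 0 = (qpochhammer_inf (ce z) (ce z))\<^sup>2" by (simp add: u_def ce_def power2_eq_square)
  ultimately show ?thesis by (simp add: eq)
qed

text \<open>At a zero of \<open>f\<close> the product rule loses the term with the derivative of
  \<open>m\<close>. Hence simplicity of zeros propagates along the lattice, and quotients of
  derivatives inherit the periodicity of quotients of functions.\<close>

lemma deriv_quasi_periodic:
  assumes f: "f holomorphic_on UNIV" and m: "m holomorphic_on UNIV"
    and per: "\<And>w. f (w + a) = m w * f w" and zero: "f w = 0"
  shows "deriv f (w + a) = m w * deriv f w"
proof -
  have f': "(f has_field_derivative deriv f w) (at w)"
    using f by (auto intro: holomorphic_derivI)
  have m': "(m has_field_derivative deriv m w) (at w)"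
    using m by (auto intro: holomorphic_derivI)
  have "((\<lambda>w. f (w + a)) has_field_derivative m w * deriv f w) (at w)"
    unfolding per using DERIV_mult[OF m' f'] zero by (simp add: mult_ac)
  thus ?thesis by (intro DERIV_imp_deriv) (simp add: DERIV_shift)
qed

text \<open>This is the square of Weber's identity for his three functions f, f1, f2, whose product
  is the square root of 2. It is a second place, besides \<open>w = 0\<close>, where theta products
  for different lattices can be compared.\<close>

lemma theta_prod_half_periods:
  assumes z: "Im z > 0"
  shows "theta_prod (1/2) z * theta_prod (z/2) z * theta_prod ((1+z)/2) z = 2"
proof -
  define q where "q = ce z"
  define h where "h = ce (z/2)"
  have h: "h\<^sup>2 = q" "h \<noteq> 0" unfolding q_def h_def ce_power by simp_all
  have q: "norm q < 1" using norm_ce_less_1[OF z] by (simp add: q_def)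
  have q0: "q / h = h" "q / (-h) = -h" using h by (simp_all add: field_simps power2_eq_square)
  have ce2: "ce ((1+z)/2) = - h" using ce_add[of "1/2" "z/2"] by (simp add: h_def add_divide_distrib)
  define A where "A = (\<lambda>a. qpochhammer_inf a q)"
  have t1: "theta_prod (1/2) z = A (-1) * A (-q)"
    by (simp add: theta_prod_def A_def q_def)
  have t2: "theta_prod (z/2) z = (A h)\<^sup>2"
    using q0 by (simp add: theta_prod_def A_def q_def[symmetric] h_def[symmetric] power2_eq_square)
  have t3: "theta_prod ((1+z)/2) z = (A (-h))\<^sup>2"
    using q0 by (simp add: theta_prod_def A_def q_def[symmetric] ce2 power2_eq_square)
  have "A (-1) = 2 * A (-q)"
    using qpochhammer_inf_rec[OF q, of "-1"] by (simp add: A_def)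
  moreover have "A h * A (-h) = qpochhammer_inf q (q\<^sup>2)"
    using qpochhammer_inf_mult_uminus[OF q, of h] h by (simp add: A_def)
  moreover have "A q * A (-q) = qpochhammer_inf (q\<^sup>2) (q\<^sup>2)"
    using qpochhammer_inf_mult_uminus[OF q, of q] by (simp add: A_def)
  moreover have "qpochhammer_inf q (q\<^sup>2) * qpochhammer_inf (q\<^sup>2) (q\<^sup>2) = A q"
    using qpochhammer_inf_even_odd[OF q, of q] by (simp add: A_def power2_eq_square)
  moreover have "A q \<noteq> 0" using qpochhammer_inf_nonzero[OF q q] by (simp add: A_def)
  \<comment> \<open>Euler's identity: partitions into distinct parts and into odd parts are
    equinumerous.\<close>
  ultimately have "A (-q) * (A h * A (-h)) = 1"
    by (metis mult.assoc mult.commute mult_cancel_left2)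
  hence "2 * (A (-q) * (A h * A (-h)))\<^sup>2 = 2" by simp
  thus ?thesis unfolding t1 t2 t3 \<open>A (-1) = 2 * A (-q)\<close>
    by (simp add: power2_eq_square mult_ac)
qed

section \<open>The inversion formula for the discriminant\<close>

definition Delta :: "complex \<Rightarrow> complex" where
  "Delta z = ce z * qpochhammer_inf (ce z) (ce z) ^ 24"

lemma Im_uminus_inverse_pos: "Im z > 0 \<Longrightarrow> Im (- 1 / z) > 0"
  by (auto simp: Im_divide intro!: divide_pos_pos add_nonneg_pos)

text \<open>Division by \<open>z\<close> turns the shifts by 1 and \<open>z\<close> into shifts by
  \<open>1 / z\<close> (minus the new period) and by 1. Both claims are therefore invariant under
  the lattice, and only zeros in the half-open parallelogram remain.\<close>

lemma theta_prod_zeros: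
  assumes z: "Im z > 0" and p0: "theta_prod w z = 0"
  shows "theta_prod (w / z) (- 1 / z) = 0 \<and> deriv (\<lambda>w. theta_prod w z) w \<noteq> 0"
proof -
  define p where "p = (\<lambda>w. theta_prod w z)"
  define z' where "z' = - 1 / z"
  have z': "Im z' > 0" unfolding z'_def by (rule Im_uminus_inverse_pos[OF z])
  have z0: "z \<noteq> 0" using z by auto
  note q = norm_ce_less_1[OF z]
  have hp: "p holomorphic_on UNIV" unfolding p_def by (rule theta_prod_holomorphic[OF z])
  define P where "P = (\<lambda>w. p w = 0 \<longrightarrow> theta_prod (w / z) z' = 0 \<and> deriv p w \<noteq> 0)"
  have "P w"
  proof (rule lattice_induct[OF z, of P])
    fix w
    have 1: "p (w + 1) = 1 * p w" for w by (simp add: p_def theta_prod_plus_1)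
    have "theta_prod ((w + 1) / z) z' = 0 \<longleftrightarrow> theta_prod (w / z) z' = 0"
      using theta_prod_minus_period[OF z', of "w / z"] by (simp add: z'_def add_divide_distrib)
    moreover have "p w = 0 \<Longrightarrow> deriv p (w + 1) = 1 * deriv p w"
      by (rule deriv_quasi_periodic[OF hp _ 1]) auto
    ultimately show "P w \<longleftrightarrow> P (w + 1)" using 1[of w] by (auto simp: P_def)
    have 2: "p (w + z) = (- 1 / ce w) * p w" for w using theta_prod_plus_period[OF z] by (simp add: p_def)
    have "theta_prod ((w + z) / z) z' = theta_prod (w / z) z'"
      using z0 theta_prod_plus_1[of "w/z" z'] by (simp add: add_divide_distrib)
    moreover have "p w = 0 \<Longrightarrow> deriv p (w + z) = (- 1 / ce w) * deriv p w"
      by (rule deriv_quasi_periodic[OF hp _ 2]) (auto intro!: holomorphic_intros ce_holomorphic)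
    ultimately show "P w \<longleftrightarrow> P (w + z)" using 2[of w] by (auto simp: P_def)
  next
    fix s t :: real assume st: "s \<in> {0..<1}" "t \<in> {0..<1}"
    define w where "w = of_real s + of_real t * z"
    have Im_w: "Im w = t * Im z" by (simp add: w_def)
    \<comment> \<open>In the parallelogram \<open>ce w\<close> has modulus at most 1 and, since
      \<open>t < 1\<close>, greater than that of \<open>ce z\<close>. So only the leading factor
      \<open>1 - ce w\<close> can vanish.\<close>
    have "norm (ce z / ce w) < 1"
      using st z by (simp add: norm_divide norm_ce Im_w flip: exp_diff)
    hence n1: "qpochhammer_inf (ce z / ce w) (ce z) \<noteq> 0" by (rule qpochhammer_inf_nonzero[OF q])
    have "norm (ce w) \<le> 1" using st z by (simp add: norm_ce Im_w)
    hence "norm (ce w * ce z) < 1"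
      using q by (simp add: norm_mult) (metis mult_left_le_one_le norm_ge_zero order_le_less_trans)
    hence n2: "qpochhammer_inf (ce w * ce z) (ce z) \<noteq> 0" by (rule qpochhammer_inf_nonzero[OF q])
    show "P (of_real s + of_real t * z)" unfolding P_def w_def[symmetric]
    proof
      assume "p w = 0"
      hence "ce w = 1"
        using n1 n2 by (simp add: p_def theta_prod_def qpochhammer_inf_rec[OF q, of "ce w"])
      hence "w \<in> \<int>" by (simp add: ce_eq_1_iff)
      then obtain n :: int where n: "w = of_int n" by (auto elim: Ints_cases)
      hence "t = 0" using Im_w z by simp
      hence "s = of_int n" using n by (simp add: w_def complex_eq_iff)
      hence "s = 0" using st by auto
      hence [simp]: "w = 0" by (simp add: w_def \<open>t = 0\<close>)
      have "deriv p 0 \<noteq> 0"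
        using DERIV_imp_deriv[OF theta_prod_deriv_0[OF z]] qpochhammer_inf_nonzero[OF q q]
        by (simp add: p_def)
      thus "theta_prod (w / z) z' = 0 \<and> deriv p w \<noteq> 0"
        using theta_prod_0[OF z'] by simp
    qed
  qed
  thus ?thesis using p0 by (simp add: P_def p_def z'_def)
qed

text \<open>The theta products for \<open>z\<close> and \<open>- 1 / z\<close> have, up to a Gaussian factor, the same zeros and
  the same multipliers, so their quotient is constant by Liouville's theorem. The constant is read
  off at \<open>w = 0\<close>, and once more, cubed, from the three half periods.\<close>
theorem Delta_S:
  assumes z: "Im z > 0"
  shows "Delta (- 1 / z) = z ^ 12 * Delta z"
proof -
  define z' where "z' = - 1 / z"
  have z': "Im z' > 0" unfolding z'_def by (rule Im_uminus_inverse_pos[OF z])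
  have z0: "z \<noteq> 0" using z by auto
  define p where "p = (\<lambda>w. theta_prod w z)"
  \<comment> \<open>The exponent is determined by the multipliers wanted for \<open>r\<close>: its
    increment under \<open>w + 1\<close> must cancel \<open>- ce ((w + 1) / z)\<close>, and its
    increment under \<open>w + z\<close> must produce \<open>- 1 / ce w\<close>.\<close>
  define E where "E = (\<lambda>w. exp (of_real pi * \<i> * (w - (w\<^sup>2 + w) / z)))"
  define r where "r = (\<lambda>w. E w * theta_prod (w / z) z')"
  have hp: "p holomorphic_on UNIV" unfolding p_def by (rule theta_prod_holomorphic[OF z])
  have hr: "r holomorphic_on UNIV"
  proof -
    have "(\<lambda>w. w / z) holomorphic_on UNIV" using z0 by (auto intro!: holomorphic_intros)
    from holomorphic_on_compose_gen[OF this theta_prod_holomorphic[OF z']] show ?thesis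
      unfolding r_def E_def o_def using z0 by (auto intro!: holomorphic_intros)
  qed
  have zeros: "r w = 0 \<and> deriv p w \<noteq> 0" if "p w = 0" for w
    using theta_prod_zeros[OF z, of w] that by (simp add: p_def r_def z'_def)
  define m where "m = (\<lambda>w. - 1 / ce w)"
  have hm: "m holomorphic_on UNIV" unfolding m_def by (auto intro!: holomorphic_intros ce_holomorphic)
  have p1: "p (w + 1) = 1 * p w" for w by (simp add: p_def theta_prod_plus_1)
  have p2: "p (w + z) = m w * p w" for w using theta_prod_plus_period[OF z] by (simp add: p_def m_def)
  have r1: "r (w + 1) = 1 * r w" for w
  proof -
    have "theta_prod ((w + 1) / z) z' = - theta_prod (w / z) z' * ce (w / z) / ce z'"
      using theta_prod_minus_period[OF z', of "w / z"] by (simp add: z'_def add_divide_distrib)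
    also have "ce (w / z) / ce z' = ce ((w + 1) / z)"
      using ce_add[of "w / z" "- z'"] by (simp add: z'_def add_divide_distrib ce_minus[of "- 1 / z"] divide_inverse distrib_right flip: ce_minus)
    hence "- theta_prod (w / z) z' * ce (w / z) / ce z' = - theta_prod (w / z) z' * ce ((w + 1) / z)"
      by (metis times_divide_eq_right)
    finally have *: "theta_prod ((w + 1) / z) z' = - theta_prod (w / z) z' * ce ((w + 1) / z)" .
    have "E (w + 1) = E w * exp (of_real pi * \<i> - 2 * of_real pi * \<i> * ((w + 1) / z))"
      unfolding E_def exp_add[symmetric] using z0
      by (intro arg_cong[of _ _ exp]) (simp add: field_simps power2_eq_square)
    hence "E (w + 1) = - E w / ce ((w + 1) / z)" by (simp add: exp_diff ce_def)
    thus ?thesis unfolding r_def * by simp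
  qed
  have r2: "r (w + z) = m w * r w" for w
  proof -
    have "theta_prod ((w + z) / z) z' = theta_prod (w / z) z'"
      using z0 theta_prod_plus_1[of "w/z" z'] by (simp add: add_divide_distrib)
    moreover have "E (w + z) = E w * exp (- (of_real pi * \<i>) - 2 * of_real pi * \<i> * w)"
      unfolding E_def exp_add[symmetric] using z0
      by (intro arg_cong[of _ _ exp]) (simp add: field_simps power2_eq_square)
    hence "E (w + z) = m w * E w" by (simp add: exp_diff exp_minus ce_def m_def)
    ultimately show ?thesis by (simp add: r_def)
  qed
  define R where "R = (\<lambda>w. if p w = 0 then deriv r w / deriv p w else r w / p w)"
  have hR: "R holomorphic_on UNIV" unfolding R_def by (rule quotient_holomorphic[OF hr hp zeros])
  have R1: "R (w + 1) = R w" for w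
    using deriv_quasi_periodic[OF hp _ p1, of w] deriv_quasi_periodic[OF hr _ r1, of w] zeros[of w]
    by (auto simp: R_def p1 r1)
  have R2: "R (w + z) = R w" for w
    using deriv_quasi_periodic[OF hp hm p2, of w] deriv_quasi_periodic[OF hr hm r2, of w] zeros[of w]
    by (auto simp: R_def p2 r2 m_def)
  obtain C where C: "\<And>w. R w = C"
    by (rule doubly_periodic_entire_constant[OF z hR R1 R2]) blast
  have rC: "r w = C * p w" for w
    using C[of w] zeros[of w] by (auto simp: R_def split: if_splits)
  define A where "A = qpochhammer_inf (ce z) (ce z)"
  define A' where "A' = qpochhammer_inf (ce z') (ce z')"
  have A0: "A \<noteq> 0" unfolding A_def
    by (intro qpochhammer_inf_nonzero norm_ce_less_1 z)
  have "C = A'\<^sup>2 / (z * A\<^sup>2)"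
  proof -
    have "((\<lambda>w. C * p w) has_field_derivative C * (- (2 * of_real pi * \<i>) * A\<^sup>2)) (at 0)"
      unfolding p_def A_def by (intro DERIV_cmult theta_prod_deriv_0 z)
    moreover have E': "(E has_field_derivative deriv E 0) (at 0)"
      by (intro holomorphic_derivI[of _ UNIV]) (auto simp: E_def intro!: holomorphic_intros z0)
    have "((\<lambda>w. theta_prod (w / z) z') has_field_derivative (- (2 * of_real pi * \<i>) * A'\<^sup>2) * (1 / z)) (at 0)"
      using theta_prod_deriv_0[OF z'] unfolding A'_def
      by (intro DERIV_chain'[of "\<lambda>w. w / z" "1 / z" 0 _ "\<lambda>w. theta_prod w z'"])
         (auto intro!: derivative_eq_intros z0)
    from DERIV_mult[OF E' this]
    have "(r has_field_derivative - (2 * of_real pi * \<i>) * A'\<^sup>2 / z) (at 0)"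
      unfolding r_def using theta_prod_0[OF z'] by (simp add: E_def)
    moreover have "r = (\<lambda>w. C * p w)" using rC by blast
    ultimately have "C * (- (2 * of_real pi * \<i>) * A\<^sup>2) = - (2 * of_real pi * \<i>) * A'\<^sup>2 / z"
      by (metis DERIV_unique)
    thus ?thesis using A0 z0 by (simp add: field_simps)
  qed
  moreover have "C ^ 12 = ce z / ce z'"
  proof -
    define th where "th = (\<lambda>w. theta_prod w z')"
    \<comment> \<open>Division by \<open>z\<close> carries the half periods for \<open>z\<close> to
      half periods for \<open>z'\<close>: the first two are interchanged, and the first and third
      are shifted by \<open>- z'\<close>.\<close>
    have a1: "th (1 / 2 / z) = - th (z'/2) * ce (z'/2) / ce z'"
      using theta_prod_minus_period[OF z', of "z'/2"] by (simp add: th_def z'_def)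
    have a2: "th (z / 2 / z) = th (1/2)" using z0 by simp
    have "(1 + z) / 2 / z = (1 + z') / 2 - z'" using z0 by (simp add: z'_def field_simps)
    hence a3: "th ((1 + z) / 2 / z) = th ((1 + z') / 2) * ce (z'/2) / ce z'"
      using theta_prod_minus_period[OF z', of "(1 + z') / 2"] ce_add[of "1/2" "z'/2"]
      by (simp add: th_def add_divide_distrib)
    have sq: "ce (z'/2) * ce (z'/2) = ce z'" by (simp add: ce_add[symmetric])
    have "th (1 / 2 / z) * th (z / 2 / z) * th ((1 + z) / 2 / z) =
        - (th (1/2) * th (z'/2) * th ((1 + z')/2)) * (ce (z'/2) * ce (z'/2)) / (ce z' * ce z')"
      unfolding a1 a2 a3 by simp
    hence th: "th (1 / 2 / z) * th (z / 2 / z) * th ((1 + z) / 2 / z) = - 2 / ce z'"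
      unfolding sq using theta_prod_half_periods[OF z'] by (simp add: th_def)
    have "(1/2 - ((1/2)\<^sup>2 + 1/2) / z) + (z/2 - ((z/2)\<^sup>2 + z/2) / z)
        + ((1+z)/2 - (((1+z)/2)\<^sup>2 + (1+z)/2) / z) = (z + 3 * z' - 1) / 2"
      using z0 by (simp add: z'_def field_simps power2_eq_square)
    hence EE: "E (1/2) * E (z/2) * E ((1+z)/2) = exp (of_real pi * \<i> * ((z + 3 * z' - 1) / 2))"
      unfolding E_def exp_add[symmetric] ring_distribs(1)[symmetric] by (simp only:)
    have "C ^ 3 * (p (1/2) * p (z/2) * p ((1+z)/2)) = r (1/2) * r (z/2) * r ((1+z)/2)"
      unfolding rC by (simp add: power3_eq_cube)
    also have "\<dots> = (E (1/2) * E (z/2) * E ((1+z)/2)) * (th (1 / 2 / z) * th (z / 2 / z) * th ((1 + z) / 2 / z))"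
      by (simp add: r_def th_def)
    finally have "C ^ 3 * 2 = (- exp (of_real pi * \<i> * ((z + 3 * z' - 1) / 2)) / ce z') * 2"
      unfolding th EE using theta_prod_half_periods[OF z] by (simp add: p_def)
    hence C3: "C ^ 3 = - exp (of_real pi * \<i> * ((z + 3 * z' - 1) / 2)) / ce z'"
      by (subst (asm) mult_cancel_right) simp
    \<comment> \<open>The half periods determine \<open>C ^ 3\<close> with half-integral exponents
      of \<open>z\<close> and \<open>z'\<close>; the fourth power makes everything expressible
      through \<open>ce\<close>.\<close>
    have "C ^ 12 = (C ^ 3) ^ 4" by simp
    also have "\<dots> = exp (of_real pi * \<i> * ((z + 3 * z' - 1) / 2)) ^ 4 / ce z' ^ 4"
      unfolding C3 by (simp add: power_divide)
    also have "exp (of_real pi * \<i> * ((z + 3 * z' - 1) / 2)) ^ 4 = ce (z + 3 * z' + (-1))"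
      unfolding ce_def exp_of_nat_mult[symmetric]
      by (intro arg_cong[of _ _ exp]) (simp add: field_simps)
    also have "\<dots> = ce z * ce z' ^ 3" unfolding ce_add ce_power by (simp add: ce_minus)
    finally show ?thesis by (simp add: eval_nat_numeral)
  qed
  ultimately have "(A'\<^sup>2 / (z * A\<^sup>2)) ^ 12 = ce z / ce z'" by simp
  hence "ce z' * A' ^ 24 = z ^ 12 * (ce z * A ^ 24)"
    using A0 z0 by (simp add: power_divide power_mult_distrib power_mult[symmetric] field_simps)
  thus ?thesis by (simp add: Delta_def A_def A'_def z'_def)
qed

section \<open>Vanishing order of modular forms at the cusp\<close>

lemma open_upper_half: "open {z. Im z > c}"
  by (intro open_Collect_less continuous_intros)

lemma connected_upper_half: "connected {z. Im z > c}"
  by (intro convex_connected convex_halfspace_Im_gt)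

lemma periodic_strip:
  fixes f :: "complex \<Rightarrow> 'a"
  assumes "\<And>z. Im z > 0 \<Longrightarrow> f (z + 1) = f z" and z: "Im z > 0"
  obtains w where "Im w = Im z" "\<bar>Re w\<bar> \<le> 1/2" "f w = f z"
proof -
  have "f (w + of_int n) = f w" if "Im w > 0" for w and n :: int
  proof (induction n rule: int_induct[of _ 0])
    case (step1 i) thus ?case using assms(1)[of "w + of_int i"] that by (simp add: algebra_simps)
  next
    case (step2 i) thus ?case using assms(1)[of "w + of_int (i - 1)"] that by (simp add: algebra_simps)
  qed auto
  from this[OF z, of "- round (Re z)"] show ?thesis
    using that[of "z + of_int (- round (Re z))"] of_int_round_abs_le[of "Re z"]
    by (simp add: abs_minus_commute)
qed

text \<open>In the strip below height 1/2 one has \<open>(norm w)\<^sup>2 \<le> 1/2\<close>, so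
  inversion at least doubles the height. The region reached is larger than the usual fundamental
  domain, but a positive lower bound on the height is all that is used.\<close>

lemma modular_reduction:
  fixes f :: "complex \<Rightarrow> 'a"
  assumes T: "\<And>z. Im z > 0 \<Longrightarrow> f (z + 1) = f z"
    and S: "\<And>z. Im z > 0 \<Longrightarrow> f (- 1 / z) = f z" and z: "Im z > 0"
  obtains w where "Im w \<ge> 1/2" "\<bar>Re w\<bar> \<le> 1/2" "f w = f z"
proof -
  have "\<exists>w. Im w \<ge> 1/2 \<and> \<bar>Re w\<bar> \<le> 1/2 \<and> f w = f z" if "Im z \<ge> (1/2) ^ Suc j" for j z
    using that
  proof (induction j arbitrary: z)
    case 0
    then show ?case by (metis periodic_strip[of f, OF T] power_one_right One_nat_def half_gt_zero order_less_le_trans zero_less_one)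
  next
    case (Suc j)
    have "(0::real) < (1/2) ^ Suc (Suc j)" by simp
    with Suc.prems have "Im z > 0" by linarith
    then obtain w where w: "Im w = Im z" "\<bar>Re w\<bar> \<le> 1/2" "f w = f z" using periodic_strip[of f, OF T] by blast
    show ?case
    proof (cases "Im w \<ge> 1/2")
      case False
      have pos: "Im w > 0" using w \<open>Im z > 0\<close> by simp
      have "(Re w)\<^sup>2 \<le> (1/2)\<^sup>2" using w(2) by (intro abs_le_square_iff[THEN iffD1]) simp
      moreover have "(Im w)\<^sup>2 \<le> (1/2)\<^sup>2" using False pos by (intro power_mono) auto
      ultimately have "(Re w)\<^sup>2 + (Im w)\<^sup>2 \<le> 1/2" by (simp add: power2_eq_square)
      moreover have "(Re w)\<^sup>2 + (Im w)\<^sup>2 > 0" using pos by (simp add: add_nonneg_pos)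
      ultimately have "2 * Im w \<le> Im w / ((Re w)\<^sup>2 + (Im w)\<^sup>2)"
        using pos mult_left_mono[of "(Re w)\<^sup>2 + (Im w)\<^sup>2" "1/2" "Im w"]
        by (simp add: pos_le_divide_eq)
      hence "Im (- 1 / w) \<ge> 2 * Im w" by (simp add: Im_divide)
      hence "Im (- 1 / w) \<ge> (1/2) ^ Suc j" using Suc.prems w(1) by simp
      from Suc.IH[OF this] show ?thesis using S[OF pos] w(3) by simp
    qed (use w in blast)
  qed
  moreover obtain j where "(1/2::real) ^ j < Im z"
    using real_arch_pow_inv[OF z, of "1/2"] by auto
  moreover have "(1/2::real) ^ Suc j \<le> (1/2) ^ j" by simp
  ultimately show ?thesis using that by (meson less_eq_real_def order_trans)
qed

text \<open>Above some height the decay bound stays below \<open>f w\<close>, so a maximum over a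
  compact rectangle containing \<open>w\<close> is one over the whole strip.\<close>

lemma attains_max_on_strip:
  fixes f :: "complex \<Rightarrow> real"
  assumes cont: "continuous_on {z. Im z > 0} f" and a: "a > 0"
    and w: "Im w \<ge> a" "\<bar>Re w\<bar> \<le> 1/2"
    and decay: "\<And>z. Im z \<ge> 1 \<Longrightarrow> f z \<le> h (Im z)" and h: "(h \<longlongrightarrow> 0) at_top" and fw: "f w > 0"
  shows "\<exists>z0. Im z0 \<ge> a \<and> \<bar>Re z0\<bar> \<le> 1/2 \<and> (\<forall>z. Im z \<ge> a \<longrightarrow> \<bar>Re z\<bar> \<le> 1/2 \<longrightarrow> f z \<le> f z0)"
proof -
  have "eventually (\<lambda>y. h y < f w) at_top" using h fw by (rule order_tendstoD)
  then obtain Y where Y: "\<And>y. y \<ge> Y \<Longrightarrow> h y < f w" by (auto simp: eventually_at_top_linorder)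
  define b where "b = Max {1, Y, Im w}"
  have b: "b \<ge> 1" "b \<ge> Y" "b \<ge> Im w" by (auto simp: b_def)
  define K where "K = cbox (Complex (-1/2) a) (Complex (1/2) b)"
  have K: "z \<in> K \<longleftrightarrow> \<bar>Re z\<bar> \<le> 1/2 \<and> a \<le> Im z \<and> Im z \<le> b" for z
    by (auto simp: K_def in_cbox_complex_iff)
  have wK: "w \<in> K" using w b by (simp add: K)
  have "continuous_on K f" by (rule continuous_on_subset[OF cont]) (use a K in auto)
  then obtain z0 where z0: "z0 \<in> K" "\<And>z. z \<in> K \<Longrightarrow> f z \<le> f z0"
    using continuous_attains_sup[of K f] wK unfolding K_def by (metis compact_cbox empty_iff)
  have "f z \<le> f z0" if z: "Im z \<ge> a" "\<bar>Re z\<bar> \<le> 1/2" for z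
  proof (cases "Im z \<le> b")
    case False
    hence "f z < f w" using decay[of z] Y[of "Im z"] b by auto
    thus ?thesis using z0(2)[OF wK] by simp
  qed (use z z0 K in auto)
  thus ?thesis using z0(1) by (auto simp: K)
qed

text \<open>Otherwise the maximum over the half plane above the line would be attained in its
  interior, and \<open>f\<close> would be constant. Periodicity is asked of the norm only, since a
  factor \<open>exp (- \<i> * of_real (b/2) * z)\<close> with real \<open>b\<close> need not be
  periodic.\<close>

lemma periodic_max_on_line:
  assumes hol: "f holomorphic_on {z. Im z > 0}" and per: "\<And>z. Im z > 0 \<Longrightarrow> norm (f (z + 1)) = norm (f z)"
    and decay: "\<And>z. Im z \<ge> 1 \<Longrightarrow> norm (f z) \<le> C * exp (- c * Im z)" and c: "c > 0"
    and y: "0 < y" "y \<le> Im z"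
  obtains z1 where "Im z1 = y" "norm (f z) \<le> norm (f z1)"
proof (rule ccontr)
  assume "\<not> thesis"
  with that have less: "norm (f z1) < norm (f z)" if "Im z1 = y" for z1
    using that by force
  have z: "Im z > 0" using y by simp
  obtain w where w: "Im w = Im z" "\<bar>Re w\<bar> \<le> 1/2" "norm (f w) = norm (f z)"
    using periodic_strip[of "\<lambda>z. norm (f z)", OF per z] by blast
  have "f w \<noteq> 0" using less[of "\<i> * y"] w(3) by force
  have lim: "((\<lambda>y. C * exp (- c * y)) \<longlongrightarrow> 0) at_top" using c by real_asymp
  have cont: "continuous_on {z. Im z > 0} (\<lambda>z. norm (f z))"
    by (intro continuous_intros holomorphic_on_imp_continuous_on hol)
  have "Im w \<ge> y" "norm (f w) > 0" using y w(1) \<open>f w \<noteq> 0\<close> by auto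
  have "\<exists>z0. Im z0 \<ge> y \<and> \<bar>Re z0\<bar> \<le> 1/2 \<and>
      (\<forall>z. Im z \<ge> y \<longrightarrow> \<bar>Re z\<bar> \<le> 1/2 \<longrightarrow> norm (f z) \<le> norm (f z0))"
    by (rule attains_max_on_strip[of _ _ w "\<lambda>y. C * exp (- c * y)"]) fact+
  then obtain z0 where z0: "Im z0 \<ge> y" "\<bar>Re z0\<bar> \<le> 1/2"
    "\<And>z. Im z \<ge> y \<Longrightarrow> \<bar>Re z\<bar> \<le> 1/2 \<Longrightarrow> norm (f z) \<le> norm (f z0)"
    by (elim exE conjE) (rule that; blast)
  have max: "norm (f v) \<le> norm (f z0)" if "Im v \<ge> y" for v
  proof -
    have "Im v > 0" using that y by simp
    then obtain v' where "Im v' = Im v" "\<bar>Re v'\<bar> \<le> 1/2" "norm (f v') = norm (f v)"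
      using periodic_strip[of "\<lambda>z. norm (f z)", OF per] by blast
    thus ?thesis using z0(3)[of v'] that by simp
  qed
  have "Im z0 > y" using less[of z0] max[OF y(2)] z0(1) by fastforce
  have "f constant_on {z. Im z > 0}"
    by (rule maximum_modulus_principle[OF hol open_upper_half connected_upper_half, of "{z. Im z > y}" z0])
       (use y max \<open>Im z0 > y\<close> open_upper_half in auto)
  then obtain k where "\<And>z. Im z > 0 \<Longrightarrow> f z = k" by (auto simp: constant_on_def)
  thus False using less[of "\<i> * y"] y z by simp
qed

text \<open>\<open>\<bar>G z\<bar>\<^sup>2 (Im z) ^ k\<close> is invariant under the modular group, hence has a maximum, at some point
  of height at least 1/2. Comparing \<open>G\<close> on that height and on half of it by the maximum principle
  limits the decay of \<open>G\<close> at the cusp.\<close>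
lemma modular_form_vanishing:
  assumes hol: "G holomorphic_on {z. Im z > 0}"
    and T: "\<And>z. Im z > 0 \<Longrightarrow> norm (G (z + 1)) = norm (G z)"
    and S: "\<And>z. Im z > 0 \<Longrightarrow> norm (G (- 1 / z)) = norm z ^ k * norm (G z)"
    and decay: "\<And>z. Im z \<ge> 1 \<Longrightarrow> norm (G z) \<le> C * exp (- b * Im z)"
    and b: "b > 4 * real k" "b \<ge> 1" and z: "Im z > 0"
  shows "G z = 0"
proof (rule ccontr)
  assume Gz: "G z \<noteq> 0"
  define f where "f = (\<lambda>z. (norm (G z))\<^sup>2 * Im z ^ k)"
  have fT: "f (z + 1) = f z" if "Im z > 0" for z using T[OF that] by (simp add: f_def)
  have fS: "f (- 1 / z) = f z" if "Im z > 0" for z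
  proof -
    have "Im (- 1 / z) = Im z / (norm z)\<^sup>2" by (simp add: Im_divide cmod_power2)
    moreover have "norm z \<noteq> 0" using that by auto
    ultimately show ?thesis unfolding f_def S[OF that]
      by (simp add: power_mult_distrib power_divide power_mult[symmetric] mult.commute)
  qed
  obtain w where w: "Im w \<ge> 1/2" "\<bar>Re w\<bar> \<le> 1/2" "f w = f z"
    using modular_reduction[of f, OF fT fS z] by blast
  have cont: "continuous_on {z. Im z > 0} f" unfolding f_def
    by (intro continuous_intros holomorphic_on_imp_continuous_on hol)
  have lim: "((\<lambda>y. C\<^sup>2 * (y ^ k / exp y)) \<longlongrightarrow> 0) at_top"
    by (intro tendsto_mult_right_zero tendsto_power_div_exp_0)
  have f_decay: "f v \<le> C\<^sup>2 * (Im v ^ k / exp (Im v))" if v: "Im v \<ge> 1" for v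
  proof -
    have "(norm (G v))\<^sup>2 \<le> (C * exp (- b * Im v))\<^sup>2" using decay[OF v] by (intro power_mono) auto
    also have "\<dots> = C\<^sup>2 * exp (2 * (- b * Im v))" unfolding power_mult_distrib exp_double ..
    also have "2 * (- b * Im v) \<le> - Im v" using v b mult_right_mono[of 1 b "Im v"] by simp
    hence "C\<^sup>2 * exp (2 * (- b * Im v)) \<le> C\<^sup>2 * exp (- Im v)" by (intro mult_left_mono) auto
    finally have "f v \<le> C\<^sup>2 * exp (- Im v) * Im v ^ k"
      unfolding f_def using v by (intro mult_right_mono) auto
    thus ?thesis by (simp add: exp_minus field_simps)
  qed
  have "f w > 0" using w(3) z Gz by (simp add: f_def)
  from attains_max_on_strip[of f "1/2" w "\<lambda>y. C\<^sup>2 * (y ^ k / exp y)",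
      OF cont _ w(1,2) f_decay lim this]
  obtain z0 where z0: "Im z0 \<ge> 1/2"
    "\<forall>z. Im z \<ge> 1/2 \<longrightarrow> \<bar>Re z\<bar> \<le> 1/2 \<longrightarrow> f z \<le> f z0" by auto
  have max: "f v \<le> f z0" if "Im v > 0" for v
    using modular_reduction[of f, OF fT fS that] z0(2) by metis
  have "f z0 > 0" using max[OF z] \<open>f w > 0\<close> w(3) by simp
  define y0 where "y0 = Im z0"
  have y0: "y0 \<ge> 1/2" using z0 by (simp add: y0_def)
  \<comment> \<open>Half of the decay is traded for growth: \<open>H\<close> still tends to 0 at the
    cusp, so the maximum principle applies, while passing from height \<open>y0\<close> to
    \<open>y0 / 2\<close> exposes a factor \<open>exp (b * y0 / 2)\<close> against a loss of only
    \<open>2 ^ k\<close>.\<close>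
  define H where "H = (\<lambda>z. G z * exp (- \<i> * of_real (b/2) * z))"
  have normH: "norm (H z) = norm (G z) * exp (b/2 * Im z)" for z by (simp add: H_def norm_mult)
  obtain z1 where z1: "Im z1 = y0 / 2" "norm (H z0) \<le> norm (H z1)"
  proof (rule periodic_max_on_line[of H C "b/2" "y0/2" z0])
    show "H holomorphic_on {z. Im z > 0}" unfolding H_def by (intro holomorphic_intros hol)
    show "norm (H (z + 1)) = norm (H z)" if "Im z > 0" for z using T[OF that] by (simp add: normH)
    show "norm (H z) \<le> C * exp (- (b/2) * Im z)" if "Im z \<ge> 1" for z
      using mult_right_mono[OF decay[OF that], of "exp (b/2 * Im z)"]
      by (simp add: normH mult.assoc flip: exp_add)
  qed (use y0 b in \<open>auto simp: y0_def\<close>)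
  have normH2: "(norm (H v))\<^sup>2 = f v * exp (b * Im v) / Im v ^ k" if "Im v > 0" for v
    using that by (simp add: f_def normH power_mult_distrib flip: exp_double)
  have "f z0 * exp (b * y0) / y0 ^ k = (norm (H z0))\<^sup>2"
    using y0 by (simp add: normH2 y0_def)
  also have "\<dots> \<le> (norm (H z1))\<^sup>2" using z1 by (intro power_mono) auto
  also have "\<dots> = f z1 * exp (b * y0 / 2) / (y0 / 2) ^ k"
    using y0 normH2[of z1] unfolding z1(1) by simp
  also have "\<dots> \<le> f z0 * exp (b * y0 / 2) / (y0 / 2) ^ k"
    using y0 z1(1) max[of z1] by (intro divide_right_mono mult_right_mono) auto
  also have "\<dots> = f z0 * exp (b * y0 / 2) / y0 ^ k * 2 ^ k"
    by (simp add: power_divide)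
  finally have "exp (b * y0) \<le> exp (b * y0 / 2) * 2 ^ k"
    using \<open>f z0 > 0\<close> y0 by (simp add: field_simps)
  also have "b * y0 = b * y0 / 2 + b * y0 / 2" by simp
  finally have "exp (b * y0 / 2) \<le> 2 ^ k" unfolding exp_add by simp
  \<comment> \<open>The bound \<open>b > 4 * real k\<close> comes from here: \<open>y0\<close> is at
    least 1/2, so \<open>b * y0 / 2\<close> is at least \<open>b / 4\<close>.\<close>
  moreover have "exp (real k) < exp (b * y0 / 2)"
  proof -
    have "b * (1/2) \<le> b * y0" using y0 b(2) by (intro mult_left_mono) auto
    hence "real k < b * y0 / 2" using b(1) by linarith
    thus ?thesis by simp
  qed
  moreover have "(2::real) ^ k \<le> exp 1 ^ k" using exp_ge_add_one_self[of 1] by (intro power_mono) auto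
  moreover have "exp 1 ^ k = exp (real k)" using exp_of_nat_mult[of k "1::real"] by simp
  ultimately show False by linarith
qed

text \<open>Holomorphic functions on a connected open set have no zero divisors: where
  \<open>g\<close> is nonzero the other factors multiply to 0, and the identity theorem extends this
  to all of \<open>S\<close>.\<close>

lemma prod_eq_0_imp_factor_eq_0:
  assumes "finite A" and S: "open S" "connected S" "S \<noteq> {}"
    and "\<And>g. g \<in> A \<Longrightarrow> g holomorphic_on S" and "\<And>z. z \<in> S \<Longrightarrow> (\<Prod>g\<in>A. g z) = (0::complex)"
  shows "\<exists>g\<in>A. \<forall>z\<in>S. g z = 0"
  using assms(1,5,6)
proof (induction A rule: finite_induct)
  case empty
  thus ?case using S(3) by auto
next
  case (insert g A)
  show ?case
  proof (cases "\<forall>z\<in>S. g z = 0")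
    case False
    then obtain z0 where z0: "z0 \<in> S" "g z0 \<noteq> 0" by blast
    define U where "U = {z\<in>S. g z \<noteq> 0}"
    have "continuous_on S g" using insert.prems(1) holomorphic_on_imp_continuous_on by blast
    hence U: "open U" unfolding U_def
      using continuous_open_preimage[OF _ S(1) open_Compl[OF closed_singleton[of 0]], of g]
      by (simp add: vimage_def Int_def)
    have "(\<Prod>g\<in>A. g z) = 0" if "z \<in> S" for z
    proof (rule analytic_continuation_open[of U S "\<lambda>z. \<Prod>g\<in>A. g z" "\<lambda>_. 0" z])
      show "(\<lambda>z. \<Prod>g\<in>A. g z) holomorphic_on S"
        using insert.prems(1) by (intro holomorphic_intros) auto
      show "(\<Prod>g\<in>A. g z) = 0" if "z \<in> U" for z
        using that insert.prems(2)[of z] insert.hyps by (auto simp: U_def)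
    qed (use U S z0 that in \<open>auto simp: U_def\<close>)
    thus ?thesis using insert by auto
  qed auto
qed

text \<open>Multiplying all the functions of the family yields a modular form for the full modular group.\<close>
lemma modular_family_vanishing:
  fixes A :: "(complex \<Rightarrow> complex) set"
  assumes fin: "finite A" and F: "F \<in> A"
    and hol: "\<And>g. g \<in> A \<Longrightarrow> g holomorphic_on {z. Im z > 0}"
    and ext: "\<And>g z. g \<in> A \<Longrightarrow> Im z \<le> 0 \<Longrightarrow> g z = 0"
    and T: "\<And>g. g \<in> A \<Longrightarrow> (\<lambda>z. g (z + 1)) \<in> A"
    and S: "\<And>g. g \<in> A \<Longrightarrow> (\<lambda>z. g (- 1 / z) / z ^ k) \<in> A"
    and bound: "\<And>g z. g \<in> A \<Longrightarrow> Im z \<ge> 1 \<Longrightarrow> norm (g z) \<le> C * exp (B * Im z)"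
    and decay: "\<And>z. Im z \<ge> 1 \<Longrightarrow> norm (F z) \<le> C' * exp (- b * Im z)"
    and b: "b > (B + 4 * real k) * real (card A)" "b \<ge> B * real (card A) + 1" and B: "B \<ge> 0"
  shows "\<exists>g\<in>A. \<forall>z. Im z > 0 \<longrightarrow> g z = 0"
proof -
  define n where "n = card A"
  have n: "n > 0" using fin F by (auto simp: n_def card_gt_0_iff)
  define G where "G = (\<lambda>z. \<Prod>g\<in>A. g z)"
  have "inj_on (\<lambda>g z. g (z + 1)) A"
  proof (rule inj_onI)
    fix g h :: "complex \<Rightarrow> complex" assume "(\<lambda>z. g (z + 1)) = (\<lambda>z. h (z + 1))"
    hence "g (z - 1 + 1) = h (z - 1 + 1)" for z by metis
    thus "g = h" by auto
  qed
  hence bT: "bij_betw (\<lambda>g z. g (z + 1)) A A"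
    using endo_inj_surj[OF fin image_subsetI] T by (simp add: bij_betw_def)
  have GT: "G (z + 1) = G z" for z
    unfolding G_def using prod.reindex_bij_betw[OF bT, of "\<lambda>g. g z"] by simp
  \<comment> \<open>Inverting the argument twice recovers a function on the half plane;
    \<open>ext\<close> settles the remaining points. Being injective on a finite set, the operation
    permutes \<open>A\<close>, so the product acquires only a power of \<open>z\<close>.\<close>
  have "inj_on (\<lambda>g z. g (- 1 / z) / z ^ k) A"
  proof (rule inj_onI)
    fix g h assume gh: "g \<in> A" "h \<in> A" and eq: "(\<lambda>z. g (- 1 / z) / z ^ k) = (\<lambda>z. h (- 1 / z) / z ^ k)"
    show "g = h"
    proof
      fix z show "g z = h z"
      proof (cases "Im z > 0")
        case True
        hence "z \<noteq> 0" by auto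
        moreover have "g (- 1 / (- 1 / z)) / (- 1 / z) ^ k = h (- 1 / (- 1 / z)) / (- 1 / z) ^ k"
          using fun_cong[OF eq] by blast
        ultimately show ?thesis by (simp add: field_simps)
      qed (use ext[OF gh(1), of z] ext[OF gh(2), of z] in simp)
    qed
  qed
  hence bS: "bij_betw (\<lambda>g z. g (- 1 / z) / z ^ k) A A"
    using endo_inj_surj[OF fin image_subsetI] S by (simp add: bij_betw_def)
  have GS: "norm (G (- 1 / z)) = norm z ^ (k * n) * norm (G z)" if "Im z > 0" for z
  proof -
    have "z \<noteq> 0" using that by auto
    have "G z = (\<Prod>g\<in>A. g (- 1 / z) / z ^ k)"
      unfolding G_def using prod.reindex_bij_betw[OF bS, of "\<lambda>g. g z"] by simp
    also have "\<dots> = G (- 1 / z) / z ^ (k * n)"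
      by (simp add: prod_dividef G_def n_def power_mult)
    finally have "G (- 1 / z) = z ^ (k * n) * G z" using \<open>z \<noteq> 0\<close> by simp
    thus ?thesis by (simp add: norm_mult norm_power)
  qed
  have "G z = 0" if "Im z > 0" for z
  \<comment> \<open>The weight is added over all \<open>n\<close> factors. The decay
    \<open>b\<close> of \<open>F\<close> is reduced by the growth \<open>B\<close> of each of the
    other \<open>n - 1\<close>.\<close>
  proof (rule modular_form_vanishing[of G "k * n" "C' * C ^ (n - 1)" "b - B * real (n - 1)" z])
    show "G holomorphic_on {z. Im z > 0}" unfolding G_def by (intro holomorphic_intros hol)
    fix z assume z: "Im z \<ge> 1"
    have "norm (G z) = norm (F z) * (\<Prod>g\<in>A - {F}. norm (g z))"
      unfolding G_def by (subst prod.remove[OF fin F]) (simp add: norm_mult prod_norm)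
    also have "\<dots> \<le> (C' * exp (- b * Im z)) * (\<Prod>g\<in>A - {F}. C * exp (B * Im z))"
      using z by (intro mult_mono prod_mono decay prod_nonneg conjI bound)
                 (use order.trans[OF norm_ge_zero decay[OF z]] in auto)
    also have "(\<Prod>g\<in>A - {F}. C * exp (B * Im z)) = C ^ (n - 1) * exp (real (n - 1) * (B * Im z))"
      using F fin by (simp add: n_def power_mult_distrib exp_of_nat_mult)
    finally show "norm (G z) \<le> C' * C ^ (n - 1) * exp (- (b - B * real (n - 1)) * Im z)"
      by (simp add: mult_ac algebra_simps flip: exp_add)
  next
    have *: "B * real (n - 1) \<le> B * real n" using B by (intro mult_left_mono) auto
    show "b - B * real (n - 1) \<ge> 1" using * b(2) by (simp add: n_def)
    show "b - B * real (n - 1) > 4 * real (k * n)" using * b(1) by (simp add: n_def algebra_simps)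
  qed (use GT GS that in auto)
  from prod_eq_0_imp_factor_eq_0[OF fin open_upper_half connected_upper_half _ hol] this
  show ?thesis unfolding G_def by (metis (mono_tags, lifting) complex_i_not_zero empty_iff imaginary_unit.sel(2) mem_Collect_eq zero_less_one)
qed

section \<open>Integer matrices acting on the discriminant\<close>

lemma Delta_plus_int: "Delta (w + of_int n) = Delta w"
proof -
  have "ce (w + of_int n) = ce w" using ce_eq_1_iff[of "of_int n"] by (simp add: ce_add)
  thus ?thesis by (simp add: Delta_def)
qed

lemma Delta_holomorphic: "Delta holomorphic_on {z. Im z > 0}"
proof -
  have "ce ` {z. Im z > 0} \<subseteq> ball 0 1" by (auto simp: norm_ce_less_1)
  from holomorphic_on_compose_gen[OF ce_holomorphic qpochhammer_inf_diag_holomorphic this]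
  have "(\<lambda>z. qpochhammer_inf (ce z) (ce z)) holomorphic_on {z. Im z > 0}" by (simp add: o_def)
  thus ?thesis unfolding Delta_def by (intro holomorphic_intros ce_holomorphic)
qed

lemma Delta_nonzero: "Im z > 0 \<Longrightarrow> Delta z \<noteq> 0"
  unfolding Delta_def using qpochhammer_inf_nonzero norm_ce_less_1 by auto

text \<open>Without its factor \<open>ce z\<close>, \<open>Delta\<close> is a continuous zero-free
  function of \<open>ce z\<close> on a compact disc of radius below 1; its extreme moduli supply the
  constants.\<close>

lemma Delta_bounds:
  assumes "\<delta> > 0"
  obtains c C where "c > 0" "\<And>z. Im z \<ge> \<delta> \<Longrightarrow> norm (Delta z) \<le> C"
    "\<And>z. Im z \<ge> \<delta> \<Longrightarrow> norm (Delta z) \<ge> c * exp (- 2 * pi * Im z)"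
proof -
  define r where "r = exp (- 2 * pi * \<delta>)"
  have r: "0 < r" "r < 1" using assms by (auto simp: r_def)
  define f where "f = (\<lambda>q. norm (qpochhammer_inf q q ^ 24))"
  have "continuous_on (cball 0 r) (\<lambda>q. qpochhammer_inf q q)"
    by (rule continuous_on_subset[OF holomorphic_on_imp_continuous_on[OF qpochhammer_inf_diag_holomorphic]])
       (use r in auto)
  hence cont: "continuous_on (cball 0 r) f" unfolding f_def by (intro continuous_intros)
  have ne: "cball (0::complex) r \<noteq> {}" using r by simp
  obtain a where a: "a \<in> cball 0 r" "\<And>q. q \<in> cball 0 r \<Longrightarrow> f a \<le> f q"
    using continuous_attains_inf[OF compact_cball ne cont] by blast
  obtain b where b: "\<And>q. q \<in> cball 0 r \<Longrightarrow> f q \<le> f b"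
    using continuous_attains_sup[OF compact_cball ne cont] by blast
  have "f a > 0" using a(1) r qpochhammer_inf_nonzero[of a a] by (simp add: f_def)
  have in_ball: "ce z \<in> cball 0 r" if "Im z \<ge> \<delta>" for z
    using that by (simp add: norm_ce r_def)
  have eq: "norm (Delta z) = exp (- 2 * pi * Im z) * f (ce z)" for z
    by (simp add: Delta_def f_def norm_mult norm_ce)
  show ?thesis
  proof (rule that[OF \<open>f a > 0\<close>, of "f b"])
    fix z assume z: "Im z \<ge> \<delta>"
    have "f (ce z) \<ge> 0" by (simp add: f_def)
    moreover have "exp (- 2 * pi * Im z) \<le> 1" using z assms by simp
    ultimately show "norm (Delta z) \<le> f b"
      unfolding eq using b[OF in_ball[OF z]] by (meson mult_left_le_one_le order_trans exp_ge_zero)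
    show "norm (Delta z) \<ge> f a * exp (- 2 * pi * Im z)"
      unfolding eq using a(2)[OF in_ball[OF z]] by (simp add: mult.commute)
  qed
qed

definition mob :: "int \<Rightarrow> int \<Rightarrow> int \<Rightarrow> int \<Rightarrow> complex \<Rightarrow> complex" where
  "mob a b c d z = (of_int a * z + of_int b) / (of_int c * z + of_int d)"

lemma mob_denom_nonzero:
  fixes a b c d :: int
  assumes "a * d - b * c > 0" "Im z > 0"
  shows "of_int c * z + of_int d \<noteq> 0"
proof
  assume *: "of_int c * z + of_int d = 0"
  hence "Im (of_int c * z + of_int d) = 0" "Re (of_int c * z + of_int d) = 0" by simp_all
  hence "c = 0" "d = 0" using assms(2) by auto
  thus False using assms(1) by simp
qed

lemma Im_mob:
  "Im (mob a b c d z) = of_int (a * d - b * c) * Im z / (norm (of_int c * z + of_int d))\<^sup>2"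
  by (simp add: mob_def Im_divide cmod_power2) (simp add: algebra_simps)

lemma Im_mob_pos: "a * d - b * c > 0 \<Longrightarrow> Im z > 0 \<Longrightarrow> Im (mob a b c d z) > 0"
  using mob_denom_nonzero[of a d b c z] unfolding Im_mob
  by (intro divide_pos_pos mult_pos_pos) (simp_all del: of_int_diff of_int_mult)

text \<open>The usual power of the determinant is left out. The value 0 off the upper half plane
  makes functions that agree on it equal, so that they can be counted in a finite set.\<close>

definition Delta_slash :: "int \<Rightarrow> int \<Rightarrow> int \<Rightarrow> int \<Rightarrow> complex \<Rightarrow> complex" where
  "Delta_slash a b c d z =
     (if Im z > 0 then Delta (mob a b c d z) / (of_int c * z + of_int d) ^ 12 else 0)"

lemma Delta_slash_add_row:
  assumes "a * d - b * c > 0"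
  shows "Delta_slash (a + n * c) (b + n * d) c d = Delta_slash a b c d"
proof
  fix z
  show "Delta_slash (a + n * c) (b + n * d) c d z = Delta_slash a b c d z"
  proof (cases "Im z > 0")
    case True
    have "mob (a + n * c) (b + n * d) c d z = mob a b c d z + of_int n"
      using mob_denom_nonzero[OF assms True] by (simp add: mob_def field_simps)
    thus ?thesis by (simp add: Delta_slash_def Delta_plus_int)
  qed (simp add: Delta_slash_def)
qed

text \<open>Left multiplication by the inversion: the factor from \<open>Delta_S\<close> is exactly
  the quotient of the two automorphy factors. Together with \<open>Delta_slash_add_row\<close> this
  supplies the row operations of the Euclidean algorithm.\<close>

lemma Delta_slash_swap_rows:
  assumes "a * d - b * c > 0"
  shows "Delta_slash (- c) (- d) a b = Delta_slash a b c d"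
proof
  fix z
  show "Delta_slash (- c) (- d) a b z = Delta_slash a b c d z"
  proof (cases "Im z > 0")
    case True
    have 1: "of_int c * z + of_int d \<noteq> 0" by (rule mob_denom_nonzero[OF assms True])
    have 2: "of_int a * z + of_int b \<noteq> 0"
      using mob_denom_nonzero[of "-c" b "-d" a z] assms True by (simp add: algebra_simps)
    have "mob (- c) (- d) a b z = - 1 / mob a b c d z"
      using 1 2 by (simp add: mob_def field_simps)
    hence "Delta (mob (- c) (- d) a b z) = mob a b c d z ^ 12 * Delta (mob a b c d z)"
      using Delta_S[OF Im_mob_pos[OF assms True]] by simp
    thus ?thesis using 1 2 True by (simp add: Delta_slash_def mob_def power_divide)
  qed (simp add: Delta_slash_def)
qed

text \<open>Changes of the argument are right multiplications and preserve the determinant, so a set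
  of all matrices of one determinant is stable under them.\<close>

lemma Delta_slash_T:
  "(\<lambda>z. Delta_slash a b c d (z + 1)) = Delta_slash a (a + b) c (c + d)"
  by (auto simp: Delta_slash_def mob_def fun_eq_iff algebra_simps)

lemma Delta_slash_S:
  "(\<lambda>z. Delta_slash a b c d (- 1 / z) / z ^ 12) = Delta_slash b (- a) d (- c)"
proof
  fix z :: complex
  show "Delta_slash a b c d (- 1 / z) / z ^ 12 = Delta_slash b (- a) d (- c) z"
  proof (cases "Im z > 0")
    case True
    hence z: "z \<noteq> 0" by auto
    have "of_int c * (- 1 / z) + of_int d = (of_int d * z + of_int (- c)) / z"
      "of_int a * (- 1 / z) + of_int b = (of_int b * z + of_int (- a)) / z"
      using z by (simp_all add: field_simps)
    hence "mob a b c d (- 1 / z) = mob b (- a) d (- c) z"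
      "(of_int c * (- 1 / z) + of_int d) ^ 12 * z ^ 12 = (of_int d * z + of_int (- c)) ^ 12"
      using z by (simp_all add: mob_def power_divide)
    thus ?thesis using True Im_uminus_inverse_pos[OF True] unfolding Delta_slash_def by simp
  next
    case False
    have "Im (- 1 / z) \<le> 0" using False by (simp add: Im_divide divide_nonpos_nonneg)
    thus ?thesis using False by (simp add: Delta_slash_def)
  qed
qed

text \<open>The Euclidean algorithm on the first column.\<close>
lemma Delta_slash_triangular:
  assumes "a * d - b * c = N" "N > 0"
  shows "\<exists>a' b' d'. a' * d' = N \<and> \<bar>b'\<bar> \<le> N \<and> Delta_slash a b c d = Delta_slash a' b' 0 d'"
  using assms(1)
proof (induction "nat \<bar>c\<bar>" arbitrary: a b c d rule: less_induct)
  case less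
  note det = less.prems
  show ?case
  proof (cases "c = 0")
    case True
    have ad: "a * d = N" using det True by simp
    have "d dvd N" "d \<noteq> 0" using ad assms(2) by auto
    hence dN: "\<bar>d\<bar> \<le> N" using dvd_imp_le_int[of N d] assms(2) by simp
    have "Delta_slash a b 0 d = Delta_slash a (b mod d) 0 d"
      using Delta_slash_add_row[of a d b 0 "- (b div d)"] ad assms(2)
      by (simp add: minus_div_mult_eq_mod)
    moreover have "\<bar>b mod d\<bar> \<le> N" using abs_mod_less[OF \<open>d \<noteq> 0\<close>, of b] dN by simp
    ultimately show ?thesis using ad True by blast
  next
    case False
    define a' where "a' = a mod c"
    define b' where "b' = b - (a div c) * d"
    have a': "a' = a + (- (a div c)) * c" by (simp add: a'_def minus_div_mult_eq_mod)
    have b': "b' = b + (- (a div c)) * d" by (simp add: b'_def)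
    have det': "a' * d - b' * c = N" unfolding a' b' det[symmetric] by (simp add: algebra_simps)
    have "Delta_slash a b c d = Delta_slash a' b' c d"
      unfolding a' b' using Delta_slash_add_row[of a d b c "- (a div c)"] det assms(2) by simp
    also have "\<dots> = Delta_slash (- c) (- d) a' b'"
      using Delta_slash_swap_rows[of a' d b' c] det' assms(2) by simp
    finally have eq: "Delta_slash a b c d = Delta_slash (- c) (- d) a' b'" .
    have "nat \<bar>a'\<bar> < nat \<bar>c\<bar>" using abs_mod_less[OF False, of a] by (simp add: a'_def)
    moreover have "(- c) * b' - (- d) * a' = N" using det' by (simp add: algebra_simps)
    ultimately show ?thesis unfolding eq using less.hyps[of a' "- c" b' "- d"] by blast
  qed
qed

lemma abs_factor_le:
  fixes a d N :: int assumes "a * d = N" "N > 0" shows "\<bar>a\<bar> \<le> N" "\<bar>d\<bar> \<le> N"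
  using assms dvd_imp_le_int[of N a] dvd_imp_le_int[of N d] by auto

definition Hecke :: "int \<Rightarrow> (complex \<Rightarrow> complex) set" where
  "Hecke N = {Delta_slash a b c d |a b c d. a * d - b * c = N}"

lemma finite_Hecke:
  assumes "N > 0" shows "finite (Hecke N)"
proof (rule finite_subset)
  show "Hecke N \<subseteq> (\<lambda>(a, b, d). Delta_slash a b 0 d) ` ({-N..N} \<times> {-N..N} \<times> {-N..N})"
  proof
    fix h assume "h \<in> Hecke N"
    then obtain a b d where "a * d = N" "\<bar>b\<bar> \<le> N" "h = Delta_slash a b 0 d"
      using Delta_slash_triangular[OF _ assms] by (auto simp: Hecke_def) metis
    with abs_factor_le[OF this(1) assms]
    show "h \<in> (\<lambda>(a, b, d). Delta_slash a b 0 d) ` ({-N..N} \<times> {-N..N} \<times> {-N..N})"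
      by (intro image_eqI[of _ _ "(a, b, d)"]) (auto simp: abs_le_iff)
  qed
qed auto

text \<open>In triangular form the argument of \<open>Delta\<close> has imaginary part
  \<open>N * Im z\<close> divided by the square of \<open>d\<close>, which lies between
  \<open>1 / N\<close> and \<open>N * Im z\<close>. Hence one pair of constants serves the whole
  family.\<close>

lemma Hecke_bounds:
  assumes N: "N > 0"
  obtains c C where "c > 0" "C \<ge> 0" "\<And>h z. h \<in> Hecke N \<Longrightarrow> Im z \<ge> 1 \<Longrightarrow> norm (h z) \<le> C"
    "\<And>h z. h \<in> Hecke N \<Longrightarrow> Im z \<ge> 1 \<Longrightarrow> norm (h z) \<ge> c * exp (- 2 * pi * N * Im z)"
proof -
  have "1 / real_of_int N > 0" using N by simp
  then obtain c C where c: "c > 0" and bd: "\<And>z. Im z \<ge> 1 / N \<Longrightarrow> norm (Delta z) \<le> C"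
    "\<And>z. Im z \<ge> 1 / N \<Longrightarrow> norm (Delta z) \<ge> c * exp (- 2 * pi * Im z)"
    using Delta_bounds by blast
  have main: "norm (h z) \<le> C \<and> norm (h z) \<ge> c / N ^ 12 * exp (- 2 * pi * N * Im z)"
    if h: "h \<in> Hecke N" and z: "Im z \<ge> 1" for h z
  proof -
    from h obtain a b d where ad: "a * d = N" "h = Delta_slash a b 0 d"
      using Delta_slash_triangular[OF _ N] by (auto simp: Hecke_def) metis
    define w where "w = mob a b 0 d z"
    have "d \<noteq> 0" using ad N by auto
    have hz: "norm (h z) = norm (Delta w) / \<bar>real_of_int d\<bar> ^ 12"
      using z ad by (simp add: Delta_slash_def w_def norm_divide norm_power)
    have d1: "1 \<le> \<bar>real_of_int d\<bar>" "\<bar>real_of_int d\<bar> \<le> N"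
      using \<open>d \<noteq> 0\<close> abs_factor_le(2)[OF ad(1) N] by linarith+
    have d2: "1 \<le> (real_of_int d)\<^sup>2" using d1 by (metis one_le_power power2_abs)
    have d3: "(real_of_int d)\<^sup>2 \<le> (real_of_int N)\<^sup>2" using d1 by (metis power2_abs power_mono abs_ge_zero)
    have Imw: "Im w = N * Im z / (real_of_int d)\<^sup>2" unfolding w_def Im_mob using ad by simp
    have NIz: "1 * real_of_int N \<le> Im z * N" using z N by (intro mult_right_mono) auto
    have w1: "Im w \<ge> 1 / N"
    proof -
      have "1 / real_of_int N = N / (real_of_int N)\<^sup>2" using N by (simp add: power2_eq_square)
      also have "\<dots> \<le> N * Im z / (real_of_int d)\<^sup>2"
        using N NIz d2 d3 by (intro frac_le) (auto simp: mult.commute)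
      finally show ?thesis by (simp add: Imw)
    qed
    have w2: "Im w \<le> N * Im z"
    proof -
      have "N * Im z * 1 \<le> N * Im z * (real_of_int d)\<^sup>2" using z N d2 by (intro mult_left_mono) auto
      thus ?thesis unfolding Imw using d2 \<open>d \<noteq> 0\<close> by (simp add: divide_le_eq)
    qed
    have C: "norm (Delta w) \<le> C" by (rule bd(1)[OF w1])
    have d12: "1 \<le> \<bar>real_of_int d\<bar> ^ 12" "\<bar>real_of_int d\<bar> ^ 12 \<le> N ^ 12"
      using one_le_power[OF d1(1)] power_mono[OF d1(2) abs_ge_zero] by (simp_all only: of_int_power)
    have "norm (h z) \<le> norm (Delta w) / 1" unfolding hz using d12 by (intro divide_left_mono) auto
    hence "norm (h z) \<le> C" using C by simp
    moreover have "c / N ^ 12 * exp (- 2 * pi * N * Im z) \<le> norm (h z)"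
    proof -
      have "c * exp (- 2 * pi * (N * Im z)) \<le> c * exp (- 2 * pi * Im w)"
        using w2 c by (intro mult_left_mono) auto
      also have "\<dots> \<le> norm (Delta w)" by (rule bd(2)[OF w1])
      finally have "c * exp (- 2 * pi * (N * Im z)) / N ^ 12 \<le> norm (h z)"
        unfolding hz using d12 c by (intro frac_le) auto
      thus ?thesis by (simp add: mult_ac)
    qed
    ultimately show ?thesis by blast
  qed
  show ?thesis
  proof (rule that[of "c / N ^ 12" "max C 0"])
    show "norm (h z) \<le> max C 0" if "h \<in> Hecke N" "Im z \<ge> 1" for h z
      using main[OF that] by (simp add: le_max_iff_disj)
  qed (use c N main in auto)
qed

lemma Delta_slash_holomorphic:
  assumes "a * d - b * c > 0"
  shows "Delta_slash a b c d holomorphic_on {z. Im z > 0}"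
proof -
  have ne: "of_int c * z + of_int d \<noteq> 0" if "z \<in> {z. Im z > 0}" for z
    using mob_denom_nonzero[OF assms] that by simp
  have "mob a b c d holomorphic_on {z. Im z > 0}"
    unfolding mob_def by (intro holomorphic_intros ne)
  from holomorphic_on_compose_gen[OF this Delta_holomorphic]
  have "(\<lambda>z. Delta (mob a b c d z)) holomorphic_on {z. Im z > 0}"
    using Im_mob_pos[OF assms] by (auto simp: o_def)
  hence "(\<lambda>z. Delta (mob a b c d z) / (of_int c * z + of_int d) ^ 12) holomorphic_on {z. Im z > 0}"
    by (intro holomorphic_intros) (use ne in auto)
  thus ?thesis by (rule holomorphic_transform) (auto simp: Delta_slash_def)
qed

lemma Delta_slash_nonzero:
  assumes "a * d - b * c > 0" "Im z > 0" shows "Delta_slash a b c d z \<noteq> 0"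
  using assms Delta_nonzero[OF Im_mob_pos[OF assms]] mob_denom_nonzero[OF assms]
  by (simp add: Delta_slash_def)

section \<open>The relation\<close>

lemma PiQ_power_12:
  assumes z: "Im z > 0"
  shows "PiQ z ^ 12 = (Delta (2 * z))\<^sup>2 / Delta z"
proof -
  define q where "q = ce z"
  have q: "norm q < 1" using norm_ce_less_1[OF z] by (simp add: q_def)
  have qpow: "qpow z 1 = q" "qpow z (1/4) ^ 12 = q ^ 3" "ce (2 * z) = q\<^sup>2"
    by (simp_all add: qpow_def q_def ce_def of_rat_divide mult_ac flip: exp_of_nat_mult)
  define X where "X = qpochhammer_inf (q\<^sup>2) (q\<^sup>2)"
  define Y where "Y = qpochhammer_inf q (q\<^sup>2)"
  have YX: "qpochhammer_inf q q = Y * X"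
    using qpochhammer_inf_even_odd[OF q, of q] by (simp add: X_def Y_def power2_eq_square)
  have "qpochhammer_inf q q \<noteq> 0" by (rule qpochhammer_inf_nonzero[OF q q])
  hence ne: "X \<noteq> 0" "Y \<noteq> 0" "q \<noteq> 0" unfolding YX by (auto simp: q_def)
  have "PiQ z ^ 12 = q ^ 3 * X ^ 24 / Y ^ 24"
    unfolding PiQ_def qpow Let_def
    by (simp add: power_mult_distrib power_divide qpow X_def Y_def flip: power_mult)
  also have "\<dots> = (q\<^sup>2 * X ^ 24)\<^sup>2 / (q * (Y * X) ^ 24)"
    using ne by (simp add: field_simps power2_eq_square power3_eq_cube)
  finally show ?thesis unfolding Delta_def qpow q_def[symmetric] YX X_def .
qed

text \<open>\<open>Pi12 n a b c d\<close> is the image of \<open>z \<mapsto> PiQ (n z) ^ 12\<close>, of weight 12, under the weight 12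
  slash operator of the matrix with rows \<open>a b\<close> and \<open>c d\<close>.\<close>
definition Pi12 :: "nat \<Rightarrow> int \<Rightarrow> int \<Rightarrow> int \<Rightarrow> int \<Rightarrow> complex \<Rightarrow> complex" where
  "Pi12 n a b c d z = (Delta_slash (2 * int n * a) (2 * int n * b) c d z)\<^sup>2 /
     Delta_slash (int n * a) (int n * b) c d z"

text \<open>Weights combine as 24 - 12 = 12: \<open>t\<close> stands for the twelfth power of an
  automorphy factor, present twice above and once below.\<close>

lemma square_divide_scale: "t \<noteq> 0 \<Longrightarrow> (x / t)\<^sup>2 * t / y = x\<^sup>2 / (y * (t :: 'a :: field))"
  by (simp add: power2_eq_square field_simps)

lemma det_scale:
  fixes a b c d :: int
  assumes "a * d - b * c = 1"
  shows "(2 * int n * a) * d - (2 * int n * b) * c = 2 * int n" "(int n * a) * d - (int n * b) * c = int n"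
proof -
  have "(2 * int n * a) * d - (2 * int n * b) * c = 2 * int n * (a * d - b * c)"
    "(int n * a) * d - (int n * b) * c = int n * (a * d - b * c)" by (simp_all add: algebra_simps)
  thus "(2 * int n * a) * d - (2 * int n * b) * c = 2 * int n" "(int n * a) * d - (int n * b) * c = int n"
    using assms by simp_all
qed

lemma Pi12_eq:
  assumes n: "n > 0" and det: "a * d - b * c = 1" and z: "Im z > 0"
  shows "Pi12 n a b c d z = PiQ (of_nat n * mob a b c d z) ^ 12 / (of_int c * z + of_int d) ^ 12"
proof -
  have "Im (of_nat n * mob a b c d z) > 0" using Im_mob_pos[of a d b c z] det z n by simp
  moreover have "mob (int n * a) (int n * b) c d z = of_nat n * mob a b c d z"
    "mob (2 * int n * a) (2 * int n * b) c d z = 2 * (of_nat n * mob a b c d z)"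
    by (simp_all add: mob_def algebra_simps)
  moreover have "of_int c * z + of_int d \<noteq> 0" using mob_denom_nonzero[of a d b c z] det z by simp
  ultimately show ?thesis using z
    by (simp add: Pi12_def PiQ_power_12 Delta_slash_def square_divide_scale)
qed

lemma Pi12_ext: "Im z \<le> 0 \<Longrightarrow> Pi12 n a b c d z = 0"
  by (simp add: Pi12_def Delta_slash_def)

lemma Pi12_T: "Pi12 n a b c d (z + 1) = Pi12 n a (a + b) c (c + d) z"
  using fun_cong[OF Delta_slash_T, of _ _ _ _ z] by (simp add: Pi12_def algebra_simps)

lemma Pi12_S: "Pi12 n a b c d (- 1 / z) / z ^ 12 = Pi12 n b (- a) d (- c) z"
proof (cases "z = 0")
  case False
  have S: "Delta_slash b (- a) d (- c) z = Delta_slash a b c d (- 1 / z) / z ^ 12" for a b c d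
    using fun_cong[OF Delta_slash_S] by metis
  show ?thesis unfolding Pi12_def mult_minus_right S using False by (simp add: square_divide_scale)
qed (simp add: Pi12_ext)

lemma Pi12_holomorphic:
  assumes "n > 0" "a * d - b * c = 1"
  shows "Pi12 n a b c d holomorphic_on {z. Im z > 0}"
proof -
  have det: "(2 * int n * a) * d - (2 * int n * b) * c > 0" "(int n * a) * d - (int n * b) * c > 0"
    using det_scale[OF assms(2), of n] assms(1) by linarith+
  show ?thesis unfolding Pi12_def using Delta_slash_nonzero[OF det(2)]
    by (intro holomorphic_intros Delta_slash_holomorphic det) auto
qed

definition Pi12_orbit :: "nat \<Rightarrow> (complex \<Rightarrow> complex) set" where
  "Pi12_orbit n = {Pi12 n a b c d |a b c d. a * d - b * c = 1}"

text \<open>A conjugate is determined by its numerator and denominator, each from a finite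
  set.\<close>

lemma finite_Pi12_orbit:
  assumes "n > 0" shows "finite (Pi12_orbit n)"
proof (rule finite_subset)
  show "Pi12_orbit n \<subseteq> (\<lambda>(g, h) z. (g z)\<^sup>2 / h z) ` (Hecke (2 * int n) \<times> Hecke (int n))"
  proof
    fix f assume "f \<in> Pi12_orbit n"
    then obtain a b c d where "a * d - b * c = 1" and f: "f = Pi12 n a b c d"
      by (auto simp: Pi12_orbit_def)
    from det_scale[OF this(1), of n]
    have "Delta_slash (2 * int n * a) (2 * int n * b) c d \<in> Hecke (2 * int n)"
      "Delta_slash (int n * a) (int n * b) c d \<in> Hecke (int n)" unfolding Hecke_def by blast+
    thus "f \<in> (\<lambda>(g, h) z. (g z)\<^sup>2 / h z) ` (Hecke (2 * int n) \<times> Hecke (int n))"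
      unfolding f by (intro image_eqI[of _ _ "(Delta_slash (2 * int n * a) (2 * int n * b) c d,
        Delta_slash (int n * a) (int n * b) c d)"]) (auto simp: Pi12_def)
  qed
qed (use assms finite_Hecke in auto)

text \<open>The numerator is bounded, so growth at the cusp comes only from the decay of the
  discriminant in the denominator.\<close>

lemma Pi12_bound:
  assumes n: "n > 0"
  obtains C where "C \<ge> 0" "\<And>a b c d z. a * d - b * c = 1 \<Longrightarrow> Im z \<ge> 1 \<Longrightarrow>
    norm (Pi12 n a b c d z) \<le> C * exp (2 * pi * n * Im z)"
proof -
  have n': "int n > 0" "2 * int n > 0" using n by auto
  obtain C where C: "C \<ge> 0" "\<And>h z. h \<in> Hecke (2 * int n) \<Longrightarrow> Im z \<ge> 1 \<Longrightarrow> norm (h z) \<le> C"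
    using Hecke_bounds[OF n'(2)] by metis
  obtain k where k: "k > 0" "\<And>h z. h \<in> Hecke (int n) \<Longrightarrow> Im z \<ge> 1 \<Longrightarrow>
      norm (h z) \<ge> k * exp (- 2 * pi * int n * Im z)"
    using Hecke_bounds[OF n'(1)] by metis
  show ?thesis
  proof (rule that[of "C\<^sup>2 / k"])
    fix a b c d :: int and z assume det: "a * d - b * c = 1" and z: "Im z \<ge> 1"
    from det_scale[OF det, of n]
    have H: "Delta_slash (2 * int n * a) (2 * int n * b) c d \<in> Hecke (2 * int n)"
      "Delta_slash (int n * a) (int n * b) c d \<in> Hecke (int n)" unfolding Hecke_def by blast+
    have "norm (Pi12 n a b c d z) \<le> C\<^sup>2 / (k * exp (- 2 * pi * int n * Im z))"
      unfolding Pi12_def norm_divide norm_power using C(2)[OF H(1) z] k(2)[OF H(2) z] k(1)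
      by (intro frac_le power_mono) auto
    thus "norm (Pi12 n a b c d z) \<le> C\<^sup>2 / k * exp (2 * pi * n * Im z)"
      by (simp add: exp_minus divide_inverse mult_ac)
  qed (use k in auto)
qed

text \<open>Elimination: one function \<open>f j0\<close> cancels the constant terms of the others, which are then
  divided by \<open>q\<close>.\<close>
lemma linear_combination_vanishing_order:
  fixes f :: "'i \<Rightarrow> complex \<Rightarrow> complex"
  assumes "finite J" "card J > M" "\<And>j. j \<in> J \<Longrightarrow> f j holomorphic_on ball 0 1"
  shows "\<exists>c h. (\<exists>j\<in>J. c j \<noteq> 0) \<and> h holomorphic_on ball 0 1 \<and>
    (\<forall>q\<in>ball 0 1. (\<Sum>j\<in>J. c j * f j q) = q ^ M * h q)"
  using assms
proof (induction M arbitrary: J f)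
  case 0
  hence "J \<noteq> {}" by auto
  thus ?case using 0
    by (intro exI[of _ "\<lambda>_. 1"] exI[of _ "\<lambda>q. \<Sum>j\<in>J. 1 * f j q"]) (auto intro!: holomorphic_intros)
next
  case (Suc M)
  have divq: "\<exists>h. h holomorphic_on ball 0 1 \<and> (\<forall>q. g q = q * h q)"
    if "g holomorphic_on ball 0 1" "g 0 = 0" for g :: "complex \<Rightarrow> complex"
    using pole_lemma[OF that(1), of 0] that(2)
    by (intro exI[of _ "\<lambda>z. if z = 0 then deriv g 0 else (g z - g 0) / (z - 0)"]) auto
  \<comment> \<open>If all constant terms vanish, any \<open>j0\<close> serves: then
    \<open>r j\<close> is \<open>0 / 0 = 0\<close> and nothing is subtracted.\<close>
  obtain j0 where j0: "j0 \<in> J" "f j0 0 \<noteq> 0 \<or> (\<forall>j\<in>J. f j 0 = 0)"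
    using Suc.prems(2) by (metis card.empty ex_in_conv not_less_zero)
  define r where "r = (\<lambda>j. f j 0 / f j0 0)"
  have "\<exists>h. h holomorphic_on ball 0 1 \<and> (\<forall>q. f j q - r j * f j0 q = q * h q)" if "j \<in> J" for j
  proof (rule divq)
    show "(\<lambda>q. f j q - r j * f j0 q) holomorphic_on ball 0 1"
      using Suc.prems(3) that j0 by (intro holomorphic_intros) auto
    show "f j 0 - r j * f j0 0 = 0" using j0 that by (auto simp: r_def)
  qed
  then obtain g where g: "\<And>j. j \<in> J \<Longrightarrow> g j holomorphic_on ball 0 1"
    "\<And>j q. j \<in> J \<Longrightarrow> f j q - r j * f j0 q = q * g j q" by metis
  have "card (J - {j0}) > M" using Suc.prems j0 by (simp add: card_Diff_singleton)
  hence "\<exists>c h. (\<exists>j\<in>J - {j0}. c j \<noteq> 0) \<and> h holomorphic_on ball 0 1 \<and>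
      (\<forall>q\<in>ball 0 1. (\<Sum>j\<in>J - {j0}. c j * g j q) = q ^ M * h q)"
    by (intro Suc.IH) (use Suc.prems(1) g(1) in auto)
  then obtain c h where ch: "\<exists>j\<in>J - {j0}. c j \<noteq> 0" "h holomorphic_on ball 0 1"
    "\<And>q. q \<in> ball 0 1 \<Longrightarrow> (\<Sum>j\<in>J - {j0}. c j * g j q) = q ^ M * h q"
    by blast
  define c' where "c' = (\<lambda>j. if j = j0 then - (\<Sum>j\<in>J - {j0}. c j * r j) else c j)"
  have "(\<Sum>j\<in>J. c' j * f j q) = q ^ Suc M * h q" if "q \<in> ball 0 1" for q
  proof -
    have "(\<Sum>j\<in>J. c' j * f j q) = c' j0 * f j0 q + (\<Sum>j\<in>J - {j0}. c j * f j q)"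
      using Suc.prems(1) j0(1) by (subst sum.remove[of J j0]) (auto simp: c'_def intro!: sum.cong)
    also have "\<dots> = (\<Sum>j\<in>J - {j0}. c j * (f j q - r j * f j0 q))"
      by (simp add: c'_def algebra_simps sum_subtractf sum_distrib_left sum_distrib_right)
    also have "\<dots> = (\<Sum>j\<in>J - {j0}. q * (c j * g j q))"
      using g(2) by (intro sum.cong) auto
    also have "\<dots> = q * (q ^ M * h q)" unfolding ch(3)[OF that, symmetric] sum_distrib_left ..
    finally show ?thesis by (simp add: mult_ac)
  qed
  moreover have "\<exists>j\<in>J. c' j \<noteq> 0" using ch(1) by (auto simp: c'_def)
  ultimately show ?case using ch(2) by blast
qed

section \<open>Expansions in q and ternary forms\<close>

lemma PiQ_power_12_q_expansion:
  assumes n: "n > 0"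
  obtains f where "f holomorphic_on ball 0 1" "\<And>z. Im z > 0 \<Longrightarrow> PiQ (of_nat n * z) ^ 12 = f (ce z)"
proof -
  have pow: "q ^ k \<in> ball 0 1" if "q \<in> ball 0 1" "k > 0" for q :: complex and k
    using that by (simp add: norm_power power_less_one_iff)
  have hol: "(\<lambda>q. qpochhammer_inf (q ^ k) (q ^ k)) holomorphic_on ball 0 1" if "k > 0" for k
  proof -
    have "(\<lambda>q::complex. q ^ k) holomorphic_on ball 0 1" by (intro holomorphic_intros)
    from holomorphic_on_compose_gen[OF this qpochhammer_inf_diag_holomorphic] show ?thesis
      using pow[OF _ that] by (auto simp: o_def image_subset_iff)
  qed
  \<comment> \<open>The twelfth power makes the exponent \<open>n / 4\<close> of q the integer
    \<open>3 * n\<close>. The denominator has no zero in the disc.\<close>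
  define f where "f = (\<lambda>q::complex. q ^ (3 * n) * qpochhammer_inf (q ^ (2 * n)) (q ^ (2 * n)) ^ 48 /
     qpochhammer_inf (q ^ n) (q ^ n) ^ 24)"
  have "f holomorphic_on ball 0 1"
    unfolding f_def using n pow[OF _ n] qpochhammer_inf_nonzero
    by (intro holomorphic_intros hol) auto
  moreover have "PiQ (of_nat n * z) ^ 12 = f (ce z)" if z: "Im z > 0" for z
  proof -
    have "Im (of_nat n * z) > 0" using n z by simp
    moreover define Q where "Q = ce z ^ n"
    moreover have "ce (of_nat n * z) = Q" "ce (2 * (of_nat n * z)) = Q\<^sup>2" "ce z ^ (2 * n) = Q\<^sup>2" "ce z ^ (3 * n) = Q ^ 3"
      by (simp_all add: Q_def ce_power mult_ac flip: power_mult)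
    moreover have "(Q\<^sup>2 * x ^ 24)\<^sup>2 / (Q * y) = Q ^ 3 * x ^ 48 / y" for x y
      using \<open>Q = ce z ^ n\<close> by (simp add: power_mult_distrib power2_eq_square power3_eq_cube flip: power_mult)
    ultimately show ?thesis by (simp add: PiQ_power_12 Delta_def f_def)
  qed
  ultimately show ?thesis by (rule that)
qed

text \<open>Not every monomial of degree \<open>2 * e\<close> occurs: a square of index pairs is
  easy to count, and with \<open>i\<close> and \<open>j\<close> at most \<open>e\<close> the
  subtraction \<open>2 * e - i - j\<close> never truncates.\<close>

definition ternary_form :: "nat \<Rightarrow> (nat \<times> nat \<Rightarrow> complex) \<Rightarrow> complex \<Rightarrow> complex \<Rightarrow> complex \<Rightarrow> complex" where
  "ternary_form e c x y z = (\<Sum>(i, j)\<in>{..e} \<times> {..e}. c (i, j) * (x ^ i * y ^ j * z ^ (2 * e - i - j)))"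

lemma ternary_form_scale:
  "ternary_form e c (t * x) (t * y) (t * z) = t ^ (2 * e) * ternary_form e c x y z"
  unfolding ternary_form_def sum_distrib_left
proof (intro sum.cong refl, safe)
  fix i j assume "i \<le> e" "j \<le> e"
  hence "2 * e = i + j + (2 * e - i - j)" by simp
  hence "t ^ (2 * e) = t ^ i * t ^ j * t ^ (2 * e - i - j)" by (metis power_add)
  thus "c (i, j) * ((t * x) ^ i * (t * y) ^ j * (t * z) ^ (2 * e - i - j)) =
      t ^ (2 * e) * (c (i, j) * (x ^ i * y ^ j * z ^ (2 * e - i - j)))"
    by (simp add: power_mult_distrib)
qed

lemma ternary_form_bound:
  assumes "norm x \<le> K" "norm y \<le> K" "norm z \<le> K"
  shows "norm (ternary_form e c x y z) \<le> (\<Sum>p\<in>{..e} \<times> {..e}. norm (c p)) * K ^ (2 * e)"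
  unfolding ternary_form_def sum_distrib_right
proof (rule sum_norm_le, safe)
  fix i j assume "i \<le> e" "j \<le> e"
  hence *: "2 * e = i + j + (2 * e - i - j)" by simp
  have "0 \<le> K" using assms(1) norm_ge_zero order_trans by blast
  hence "norm x ^ i * norm y ^ j * norm z ^ (2 * e - i - j) \<le> K ^ i * K ^ j * K ^ (2 * e - i - j)"
    using assms by (intro mult_mono power_mono) auto
  also have "\<dots> = K ^ (2 * e)" by (metis * power_add)
  finally show "norm (c (i, j) * (x ^ i * y ^ j * z ^ (2 * e - i - j))) \<le> norm (c (i, j)) * K ^ (2 * e)"
    by (simp add: norm_mult norm_power mult_left_mono)
qed

lemma mob_inverse:
  fixes a b c d :: int
  assumes det: "a * d - b * c = 1" and z: "Im z > 0"
  shows "mob a b c d (mob d (- b) (- c) a z) = z"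
proof -
  have ne: "of_int (- c) * z + of_int a \<noteq> 0" using mob_denom_nonzero[of d a "-b" "-c" z] det z by (simp add: mult.commute)
  define t where "t = of_int (- c) * z + of_int a"
  have t: "t \<noteq> 0" using ne by (simp add: t_def)
  have "of_int (a * d - b * c) = (1::complex)" unfolding det by simp
  hence D: "of_int a * of_int d - of_int b * of_int c = (1::complex)" by simp
  have "of_int a * mob d (- b) (- c) a z + of_int b = (of_int a * of_int d - of_int b * of_int c) * z / t"
    using t unfolding mob_def t_def[symmetric] by (simp add: field_simps) (simp add: t_def algebra_simps)
  moreover have "of_int c * mob d (- b) (- c) a z + of_int d = (of_int a * of_int d - of_int b * of_int c) / t"
    using t unfolding mob_def t_def[symmetric] by (simp add: field_simps) (simp add: t_def algebra_simps)
  ultimately have "of_int a * mob d (- b) (- c) a z + of_int b = z / t"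
    "of_int c * mob d (- b) (- c) a z + of_int d = 1 / t" unfolding D by simp_all
  thus ?thesis using t unfolding mob_def[of a] by simp
qed

text \<open>The order of choices is essential. The orbits and the growth rate \<open>B\<close>
  depend on \<open>n1\<close>, \<open>n2\<close>, \<open>n3\<close> alone; \<open>e\<close> is
  chosen large against them, and the coefficients come last.\<close>

lemma PiQ_ternary_relation:
  assumes n: "n1 > 0" "n2 > 0" "n3 > 0"
  obtains e c where "\<exists>p\<in>{..e} \<times> {..e}. c p \<noteq> 0"
    "\<And>z. Im z > 0 \<Longrightarrow> ternary_form e c (PiQ (of_nat n1 * z) ^ 12) (PiQ (of_nat n2 * z) ^ 12) (PiQ (of_nat n3 * z) ^ 12) = 0"
proof -
  define orbits where "orbits = Pi12_orbit n1 \<times> Pi12_orbit n2 \<times> Pi12_orbit n3"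
  have fin: "finite orbits" unfolding orbits_def using n finite_Pi12_orbit by simp
  obtain K1 where K1: "\<And>a b c d z. a * d - b * c = 1 \<Longrightarrow> Im z \<ge> 1 \<Longrightarrow> norm (Pi12 n1 a b c d z) \<le> K1 * exp (2 * pi * n1 * Im z)"
    using Pi12_bound[OF n(1)] by metis
  obtain K2 where K2: "\<And>a b c d z. a * d - b * c = 1 \<Longrightarrow> Im z \<ge> 1 \<Longrightarrow> norm (Pi12 n2 a b c d z) \<le> K2 * exp (2 * pi * n2 * Im z)"
    using Pi12_bound[OF n(2)] by metis
  obtain K3 where K3: "\<And>a b c d z. a * d - b * c = 1 \<Longrightarrow> Im z \<ge> 1 \<Longrightarrow> norm (Pi12 n3 a b c d z) \<le> K3 * exp (2 * pi * n3 * Im z)"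
    using Pi12_bound[OF n(3)] by metis
  define K where "K = Max {0, K1, K2, K3}"
  define B where "B = 2 * pi * real (n1 + n2 + n3)"
  have K: "K \<ge> 0" "K1 \<le> K" "K2 \<le> K" "K3 \<le> K" by (auto simp: K_def)
  have B: "B \<ge> 0" by (simp add: B_def)
  have weaken: "norm x \<le> K * exp (B * y)"
    if "norm x \<le> k * exp (2 * pi * real n * y)" "k \<le> K" "n \<le> n1 + n2 + n3" "y \<ge> 1" for x :: complex and k y n
  proof -
    have "k * exp (2 * pi * real n * y) \<le> K * exp (B * y)"
      unfolding B_def using that K by (intro mult_mono) (auto intro!: mult_right_mono mult_left_mono)
    thus ?thesis using that(1) by linarith
  qed
  have KB: "norm (Pi12 n1 a b c d z) \<le> K * exp (B * Im z)" "norm (Pi12 n2 a b c d z) \<le> K * exp (B * Im z)"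
    "norm (Pi12 n3 a b c d z) \<le> K * exp (B * Im z)"
    if "a * d - b * c = 1" "Im z \<ge> 1" for a b c d z
    using weaken[OF K1[OF that]] weaken[OF K2[OF that]] weaken[OF K3[OF that]] K that(2) by simp_all
  \<comment> \<open>A conjugate of the form has weight \<open>24 * e\<close> and growth rate
    \<open>2 * e * B\<close>, so \<open>modular_family_vanishing\<close> requires an order beyond
    \<open>e * (2 * B + 4 * 24)\<close> times the number of conjugates. With this \<open>e\<close>
    the square of \<open>e\<close> suffices.\<close>
  define e where "e = Suc (nat \<lceil>(2 * B + 96) * real (card orbits)\<rceil>)"
  have e: "real e \<ge> (2 * B + 96) * real (card orbits)" "e \<ge> 1"
    unfolding e_def by linarith+
  \<comment> \<open>For \<open>e \<ge> 1\<close> this is still below \<open>(e + 1)\<^sup>2\<close>,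
    the number of monomials; the added 1 yields the strict inequality and the summand 1 demanded
    later.\<close>
  define M where "M = e * e + 1"
  obtain f1 where f1: "f1 holomorphic_on ball 0 1" "\<And>z. Im z > 0 \<Longrightarrow> PiQ (of_nat n1 * z) ^ 12 = f1 (ce z)"
    using PiQ_power_12_q_expansion[OF n(1)] by blast
  obtain f2 where f2: "f2 holomorphic_on ball 0 1" "\<And>z. Im z > 0 \<Longrightarrow> PiQ (of_nat n2 * z) ^ 12 = f2 (ce z)"
    using PiQ_power_12_q_expansion[OF n(2)] by blast
  obtain f3 where f3: "f3 holomorphic_on ball 0 1" "\<And>z. Im z > 0 \<Longrightarrow> PiQ (of_nat n3 * z) ^ 12 = f3 (ce z)"
    using PiQ_power_12_q_expansion[OF n(3)] by blast
  have "card ({..e} \<times> {..e}) > M" using e(2) by (simp add: M_def card_cartesian_product)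
  moreover define mono where "mono = (\<lambda>(i, j) q. f1 q ^ i * f2 q ^ j * f3 q ^ (2 * e - i - j))"
  moreover have "mono p holomorphic_on ball 0 1" for p
    unfolding mono_def case_prod_unfold by (intro holomorphic_intros f1 f2 f3)
  ultimately have "\<exists>c h. (\<exists>p\<in>{..e} \<times> {..e}. c p \<noteq> 0) \<and> h holomorphic_on ball 0 1 \<and>
      (\<forall>q\<in>ball 0 1. (\<Sum>p\<in>{..e} \<times> {..e}. c p * mono p q) = q ^ M * h q)"
    by (intro linear_combination_vanishing_order) simp_all
  then obtain c h where c: "\<exists>p\<in>{..e} \<times> {..e}. c p \<noteq> 0" and h: "h holomorphic_on ball 0 1"
    and ch: "\<And>q. q \<in> ball 0 1 \<Longrightarrow> (\<Sum>p\<in>{..e} \<times> {..e}. c p * mono p q) = q ^ M * h q"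
    by blast
  define L where "L = (\<lambda>f1 f2 f3 z. if Im z > 0 then ternary_form e c (f1 z) (f2 z) (f3 z) else 0)"
  define F where "F = (\<lambda>a b c d. L (Pi12 n1 a b c d) (Pi12 n2 a b c d) (Pi12 n3 a b c d))"
  define A where "A = {F a b c d |a b c d. a * d - b * c = 1}"
  \<comment> \<open>The coefficients are the same for all conjugates, so each is determined by a
    triple of conjugates; this bounds \<open>card A\<close> independently of \<open>e\<close> and
    \<open>c\<close>.\<close>
  have A_sub: "A \<subseteq> (\<lambda>(f1, f2, f3). L f1 f2 f3) ` orbits"
  proof
    fix g assume "g \<in> A"
    then obtain a b c' d where g: "g = F a b c' d" "a * d - b * c' = 1" by (auto simp: A_def)
    hence "(Pi12 n1 a b c' d, Pi12 n2 a b c' d, Pi12 n3 a b c' d) \<in> orbits"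
      unfolding orbits_def Pi12_orbit_def by blast
    thus "g \<in> (\<lambda>(f1, f2, f3). L f1 f2 f3) ` orbits"
      by (rule rev_image_eqI) (simp add: g F_def)
  qed
  have finA: "finite A" and cardA: "card A \<le> card orbits"
    using finite_subset[OF A_sub] surj_card_le[OF fin A_sub] fin by auto
  \<comment> \<open>The modulus of \<open>ce z\<close> at height 1: for \<open>Im z \<ge> 1\<close>
    the argument of \<open>h\<close> stays in a compact disc.\<close>
  define r where "r = exp (- 2 * pi)"
  have r: "r < 1" by (simp add: r_def)
  have "continuous_on (cball 0 r) h"
    by (rule continuous_on_subset[OF holomorphic_on_imp_continuous_on[OF h]]) (use r in auto)
  hence "bounded (h ` cball 0 r)" by (intro compact_imp_bounded compact_continuous_image) auto
  then obtain C where C: "\<And>q. q \<in> cball 0 r \<Longrightarrow> norm (h q) \<le> C"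
    unfolding bounded_iff by blast
  have decay: "norm (F 1 0 0 1 z) \<le> C * exp (- (2 * pi * real M) * Im z)" if z: "Im z \<ge> 1" for z
  proof -
    have one: "Pi12 n 1 0 0 1 z = PiQ (of_nat n * z) ^ 12" if "n > 0" for n
      using Pi12_eq[OF that, of 1 1 0 0 z] z by (simp add: mob_def)
    have "ce z \<in> ball 0 1" using norm_ce_less_1[of z] z by simp
    from ch[OF this] have "F 1 0 0 1 z = ce z ^ M * h (ce z)"
      using z f1(2) f2(2) f3(2) by (simp add: F_def L_def one n ternary_form_def mono_def case_prod_unfold)
    hence "norm (F 1 0 0 1 z) = norm (h (ce z)) * exp (- 2 * pi * Im z) ^ M"
      by (simp add: norm_mult norm_power norm_ce)
    also have "exp (- 2 * pi * Im z) ^ M = exp (- (2 * pi * real M) * Im z)"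
      by (simp flip: exp_of_nat_mult)
    also have "norm (h (ce z)) * exp (- (2 * pi * real M) * Im z) \<le> C * exp (- (2 * pi * real M) * Im z)"
      using z by (intro mult_right_mono C) (simp_all add: norm_ce r_def)
    finally show ?thesis .
  qed
  have "\<exists>g\<in>A. \<forall>z. Im z > 0 \<longrightarrow> g z = 0"
  proof (rule modular_family_vanishing[OF finA, of "F 1 0 0 1" "24 * e"
        "(\<Sum>p\<in>{..e} \<times> {..e}. norm (c p)) * K ^ (2 * e)" "real (2 * e) * B" C "2 * pi * real M"])
    have "1 * 1 - 0 * 0 = (1::int)" by simp
    thus "F 1 0 0 1 \<in> A" unfolding A_def by blast
  next
    fix g assume "g \<in> A"
    then obtain a b c' d where g: "g = F a b c' d" and det: "a * d - b * c' = 1" by (auto simp: A_def)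
    show "g holomorphic_on {z. Im z > 0}"
    proof (rule holomorphic_transform)
      show "(\<lambda>z. ternary_form e c (Pi12 n1 a b c' d z) (Pi12 n2 a b c' d z) (Pi12 n3 a b c' d z)) holomorphic_on {z. Im z > 0}"
        unfolding ternary_form_def case_prod_unfold by (intro holomorphic_intros Pi12_holomorphic n det)
    qed (simp add: g F_def L_def)
    show "g z = 0" if "Im z \<le> 0" for z using that by (simp add: g F_def L_def)
    have "(\<lambda>z. g (z + 1)) = F a (a + b) c' (c' + d)"
      unfolding g F_def L_def by (auto simp: Pi12_T[of _ a b c' d])
    moreover have "a * (c' + d) - (a + b) * c' = 1" using det by (simp add: algebra_simps)
    ultimately show "(\<lambda>z. g (z + 1)) \<in> A" unfolding A_def by blast
    have "(\<lambda>z. g (- 1 / z) / z ^ (24 * e)) = F b (- a) d (- c')"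
    proof
      fix z
      show "g (- 1 / z) / z ^ (24 * e) = F b (- a) d (- c') z"
      proof (cases "Im z > 0")
        case True
        hence z: "z \<noteq> 0" by auto
        have S: "Pi12 n a b c' d (- 1 / z) = z ^ 12 * Pi12 n b (- a) d (- c') z" for n
          using Pi12_S[of n a b c' d z] z by (simp add: field_simps)
        thus ?thesis using True z Im_uminus_inverse_pos[OF True]
          unfolding g F_def L_def S ternary_form_scale by (simp flip: power_mult)
      next
        case False
        have "Im (- 1 / z) \<le> 0" using False by (simp add: Im_divide divide_nonpos_nonneg)
        thus ?thesis using False by (simp add: g F_def L_def)
      qed
    qed
    moreover have "b * (- c') - (- a) * d = 1" using det by (simp add: algebra_simps)
    ultimately show "(\<lambda>z. g (- 1 / z) / z ^ (24 * e)) \<in> A" unfolding A_def by blast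
    show "norm (g z) \<le> (\<Sum>p\<in>{..e} \<times> {..e}. norm (c p)) * K ^ (2 * e) * exp (real (2 * e) * B * Im z)"
      if "Im z \<ge> 1" for z
    proof -
      have "norm (g z) \<le> (\<Sum>p\<in>{..e} \<times> {..e}. norm (c p)) * (K * exp (B * Im z)) ^ (2 * e)"
        using that KB[OF det that] ternary_form_bound by (simp add: g F_def L_def)
      also have "(K * exp (B * Im z)) ^ (2 * e) = K ^ (2 * e) * exp (real (2 * e) * B * Im z)"
        by (simp only: power_mult_distrib exp_of_nat_mult[symmetric] mult.assoc)
      finally show ?thesis by (simp add: mult_ac)
    qed
  next
    have "(2 * B + 96) * real (card A) \<le> (2 * B + 96) * real (card orbits)"
      using cardA B by (intro mult_left_mono) auto
    hence "(2 * B + 96) * real (card A) \<le> real e" using e(1) by linarith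
    hence "real e * ((2 * B + 96) * real (card A)) \<le> real e * real e" by (intro mult_left_mono) auto
    moreover have "real M \<le> 2 * pi * real M"
      using mult_right_mono[of 1 "2 * pi" "real M"] pi_gt3 by simp
    ultimately have *: "real e * ((2 * B + 96) * real (card A)) + 1 \<le> 2 * pi * real M"
      by (simp add: M_def)
    thus "(real (2 * e) * B + 4 * real (24 * e)) * real (card A) < 2 * pi * real M"
      by (simp add: algebra_simps)
    have "real e * ((2 * B + 96) * real (card A)) =
        real (2 * e) * B * real (card A) + 96 * real (e * card A)" by (simp add: algebra_simps)
    thus "real (2 * e) * B * real (card A) + 1 \<le> 2 * pi * real M" using * by linarith
  qed (use B decay in simp_all)
  then obtain a b c' d where det: "a * d - b * c' = 1" and zero: "\<And>z. Im z > 0 \<Longrightarrow> F a b c' d z = 0"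
    unfolding A_def by blast
  show ?thesis
  proof (rule that[OF c])
    fix z assume z: "Im z > 0"
    \<comment> \<open>The point that the chosen matrix maps to \<open>z\<close>. There all three
      conjugates are the original values times the same nonzero \<open>t\<close>, and homogeneity
      lets \<open>t\<close> be cancelled.\<close>
    define w where "w = mob d (- b) (- c') a z"
    have w: "Im w > 0" unfolding w_def by (rule Im_mob_pos) (use det z in \<open>simp_all add: mult.commute\<close>)
    have mw: "mob a b c' d w = z" unfolding w_def by (rule mob_inverse[OF det z])
    define t where "t = 1 / (of_int c' * w + of_int d) ^ 12"
    have "t \<noteq> 0" using mob_denom_nonzero[of a d b c' w] det w by (simp add: t_def)
    have "Pi12 n a b c' d w = t * PiQ (of_nat n * z) ^ 12" if "n > 0" for n
      using Pi12_eq[OF that det w] by (simp add: mw t_def)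
    hence "0 = t ^ (2 * e) * ternary_form e c (PiQ (of_nat n1 * z) ^ 12) (PiQ (of_nat n2 * z) ^ 12) (PiQ (of_nat n3 * z) ^ 12)"
      using zero[OF w] w n by (simp add: F_def L_def flip: ternary_form_scale)
    thus "ternary_form e c (PiQ (of_nat n1 * z) ^ 12) (PiQ (of_nat n2 * z) ^ 12) (PiQ (of_nat n3 * z) ^ 12) = 0"
      using \<open>t \<noteq> 0\<close> by simp
  qed
qed

section \<open>The relation as a formal polynomial\<close>

definition ternary_exponent :: "nat \<Rightarrow> nat \<times> nat \<Rightarrow> (nat \<Rightarrow>\<^sub>0 nat)" where
  "ternary_exponent e = (\<lambda>(i, j). Poly_Mapping.single 1 (12 * i) + Poly_Mapping.single 2 (12 * j) +
     Poly_Mapping.single 3 (12 * (2 * e - i - j)))"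

lemma lookup_ternary_exponent:
  "Poly_Mapping.lookup (ternary_exponent e (i, j)) k =
     (if k = 1 then 12 * i else if k = 2 then 12 * j else if k = 3 then 12 * (2 * e - i - j) else 0)"
  by (simp add: ternary_exponent_def lookup_add lookup_single when_def)

lemma keys_ternary_exponent: "Poly_Mapping.keys (ternary_exponent e p) \<subseteq> {1, 2, 3}"
  by (cases p) (auto simp: in_keys_iff lookup_ternary_exponent split: if_splits)

text \<open>Distinct index pairs give distinct monomials, so coefficients cannot merge or cancel;
  this is what makes the polynomial nonzero.\<close>

lemma inj_ternary_exponent: "inj (ternary_exponent e)"
proof (rule injI)
  fix p q assume eq: "ternary_exponent e p = ternary_exponent e q"
  obtain i j i' j' where pq: "p = (i, j)" "q = (i', j')" by (metis prod.exhaust)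
  have "Poly_Mapping.lookup (ternary_exponent e (i, j)) k = Poly_Mapping.lookup (ternary_exponent e (i', j')) k" for k
    using eq pq by simp
  from this[of 1] this[of 2] show "p = q" by (simp add: pq lookup_ternary_exponent)
qed

theorem theorem1p1:
  fixes m :: nat and n :: "nat \<Rightarrow> nat"
  assumes "m \<ge> 3"
    and "\<And>i. i \<in> {1..m} \<Longrightarrow> n i > 0"
    and "strict_mono_on {1..m} n"
  shows "\<exists>f :: complex mvpoly. f \<noteq> 0 \<and> mv_vars f \<subseteq> {1..m} \<and> mv_homogeneous f \<and>
           (\<forall>z. Im z > 0 \<longrightarrow> mv_eval (\<lambda>i. PiQ (of_nat (n i) * z)) f = 0)"
proof -
  have "n 1 > 0" "n 2 > 0" "n 3 > 0" using assms(1,2) by auto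
  then obtain e c where c: "\<exists>p\<in>{..e} \<times> {..e}. c p \<noteq> 0"
    and zero: "\<And>z. Im z > 0 \<Longrightarrow> ternary_form e c (PiQ (of_nat (n 1) * z) ^ 12) (PiQ (of_nat (n 2) * z) ^ 12) (PiQ (of_nat (n 3) * z) ^ 12) = 0"
    using PiQ_ternary_relation by metis
  define J where "J = {..e} \<times> {..e}"
  have J: "finite J" by (simp add: J_def)
  \<comment> \<open>The factor 12 in the exponents turns the relation between twelfth powers into
    one between the functions themselves, of degree 12 times \<open>2 * e\<close>.\<close>
  define f where "f = (\<Sum>p\<in>J. Poly_Mapping.single (ternary_exponent e p) (c p))"
  have lookup_f: "Poly_Mapping.lookup f (ternary_exponent e p) = c p" if "p \<in> J" for p
    using that J inj_ternary_exponent[of e]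
    by (simp add: f_def lookup_sum lookup_single when_def inj_eq if_distrib eq_commute cong: if_cong)
  have keys_f: "Poly_Mapping.keys f \<subseteq> ternary_exponent e ` J"
  proof
    fix x assume "x \<in> Poly_Mapping.keys f"
    hence "(\<Sum>p\<in>J. Poly_Mapping.lookup (Poly_Mapping.single (ternary_exponent e p) (c p)) x) \<noteq> 0"
      by (simp add: f_def in_keys_iff lookup_sum)
    then obtain p where "p \<in> J" "Poly_Mapping.lookup (Poly_Mapping.single (ternary_exponent e p) (c p)) x \<noteq> 0"
      by (meson sum.neutral)
    thus "x \<in> ternary_exponent e ` J" by (auto simp: lookup_single when_def split: if_splits)
  qed
  have "f \<noteq> 0" using c lookup_f by (metis J_def lookup_zero)
  moreover have "mv_vars f \<subseteq> {1..m}"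
    using keys_f keys_ternary_exponent[of e] assms(1) unfolding mv_vars_def by fastforce
  moreover have "mv_homogeneous f" unfolding mv_homogeneous_def
  proof (intro exI ballI)
    fix x assume "x \<in> Poly_Mapping.keys f"
    then obtain i j where x: "x = ternary_exponent e (i, j)" "i \<le> e" "j \<le> e"
      using keys_f by (auto simp: J_def)
    have "mv_total_degree x = (\<Sum>i\<in>{1, 2, 3}. Poly_Mapping.lookup x i)"
      unfolding mv_total_degree_def
      by (rule sum.mono_neutral_left) (use keys_ternary_exponent x(1) in \<open>auto simp: in_keys_iff\<close>)
    also have "\<dots> = 24 * e" using x by (simp add: lookup_ternary_exponent)
    finally show "mv_total_degree x = 24 * e" .
  qed
  moreover have "mv_eval (\<lambda>i. PiQ (of_nat (n i) * z)) f = 0" if z: "Im z > 0" for z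
  proof -
    define x where "x = (\<lambda>i. PiQ (of_nat (n i) * z))"
    have monom: "(\<Prod>k\<in>Poly_Mapping.keys (ternary_exponent e (i, j)). x k ^ Poly_Mapping.lookup (ternary_exponent e (i, j)) k) =
        (x 1 ^ 12) ^ i * (x 2 ^ 12) ^ j * (x 3 ^ 12) ^ (2 * e - i - j)" for i j
    proof -
      have "(\<Prod>k\<in>Poly_Mapping.keys (ternary_exponent e (i, j)). x k ^ Poly_Mapping.lookup (ternary_exponent e (i, j)) k) =
          (\<Prod>k\<in>{1, 2, 3}. x k ^ Poly_Mapping.lookup (ternary_exponent e (i, j)) k)"
        by (rule prod.mono_neutral_left) (use keys_ternary_exponent in \<open>auto simp: in_keys_iff\<close>)
      thus ?thesis by (simp add: lookup_ternary_exponent mult.assoc flip: power_mult)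
    qed
    have "mv_eval x f = (\<Sum>e'\<in>ternary_exponent e ` J. Poly_Mapping.lookup f e' *
        (\<Prod>k\<in>Poly_Mapping.keys e'. x k ^ Poly_Mapping.lookup e' k))"
      unfolding mv_eval_def
      by (rule sum.mono_neutral_left) (use J keys_f in \<open>auto simp: in_keys_iff\<close>)
    also have "\<dots> = (\<Sum>p\<in>J. Poly_Mapping.lookup f (ternary_exponent e p) *
        (\<Prod>k\<in>Poly_Mapping.keys (ternary_exponent e p). x k ^ Poly_Mapping.lookup (ternary_exponent e p) k))"
      by (subst sum.reindex) (auto intro: inj_on_subset[OF inj_ternary_exponent])
    also have "\<dots> = (\<Sum>(i, j)\<in>J. c (i, j) * ((x 1 ^ 12) ^ i * (x 2 ^ 12) ^ j * (x 3 ^ 12) ^ (2 * e - i - j)))"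
      by (intro sum.cong refl) (auto simp: lookup_f monom)
    also have "\<dots> = ternary_form e c (x 1 ^ 12) (x 2 ^ 12) (x 3 ^ 12)"
      by (simp add: ternary_form_def J_def)
    finally show ?thesis using zero[OF z] by (simp add: x_def)
  qed
  ultimately show ?thesis by blast
qed

end
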